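(* The function $p\mapsto U(\operatorname{rect}^{\{p\}})$ is decreasing on the integers $p\ge2$, i.e. $U(\operatorname{rect}^{\{p+1\}})\le U(\operatorname{rect}^{\{p\}})$ for every integer $p\ge2$.
   Context: $\operatorname{rect}^{\{1\}}=\operatorname{rect}=\mathbf 1_{[-1/2,1/2]}$ and, for $p\ge2$, $\operatorname{rect}^{\{p\}}(x)=\int_{x-1/2}^{x+1/2}\operatorname{rect}^{\{p-1\}}(s)\,ds$. For a nonzero compactly supported $f\in L^2(\mathbb R)$, with $\|\cdot\|$ the $L^2$ norm and $\hat f(\omega)=\int_{\mathbb R}e^{-i\omega x}f(x)\,dx$, set $\alpha[f]=\frac1{\|f\|^2}\int x|f(x)|^2dx$, $\sigma_x^2[f]=\frac1{\|f\|^2}\int (x-\alpha[f])^2|f(x)|^2dx$, $\beta[\hat f]=\frac1{2\pi\|f\|^2}\int_{\mathbb R}\omega|\hat f(\omega)|^2d\omega$, $\sigma_\omega^2[\hat f]=\frac1{2\pi\|f\|^2}\int_{\mathbb R}(\omega-\beta[\hat f])^2|\hat f(\omega)|^2d\omega$, and $U(f)=\sigma_x^2[f]\,\sigma_\omega^2[\hat f]$. *)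

theory Defs
  imports "HOL-Analysis.Analysis"
begin

definition rect :: "real \<Rightarrow> real" where
  "rect = indicat_real {- 1/2 .. 1/2}"

text \<open>The index starts at 1; the value at index 0 is a placeholder with no mathematical meaning.\<close>

fun rect_pow :: "nat \<Rightarrow> real \<Rightarrow> real" where
  "rect_pow 0 = (\<lambda>x. 0)"
| "rect_pow (Suc 0) = rect"
| "rect_pow (Suc (Suc p)) = (\<lambda>x. LBINT s:{x - 1/2 .. x + 1/2}. rect_pow (Suc p) s)"

definition L2_norm :: "(real \<Rightarrow> complex) \<Rightarrow> real" where
  "L2_norm f = sqrt (LBINT x. (cmod (f x))\<^sup>2)"

definition fourier :: "(real \<Rightarrow> complex) \<Rightarrow> real \<Rightarrow> complex" where
  "fourier f \<omega> = (LBINT x. exp (- \<i> * of_real \<omega> * of_real x) * f x)"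

definition mean_x :: "(real \<Rightarrow> complex) \<Rightarrow> real" where
  "mean_x f = (LBINT x. x * (cmod (f x))\<^sup>2) / (L2_norm f)\<^sup>2"

definition mean_freq :: "(real \<Rightarrow> complex) \<Rightarrow> real" where
  "mean_freq f = (LBINT \<omega>. \<omega> * (cmod (fourier f \<omega>))\<^sup>2) / (2 * pi * (L2_norm f)\<^sup>2)"

text \<open>The functionals are intended for nonzero compactly supported square-integrable functions.
  The frequency variance of such a function can be infinite (it is for \<^const>\<open>rect\<close>), so the
  variances take values in \<^typ>\<open>ennreal\<close>. The Bochner integral in \<^const>\<open>mean_freq\<close> is 0 when it
  does not converge, which is harmless: the second moment about every point is then infinite.\<close>

definition var_x :: "(real \<Rightarrow> complex) \<Rightarrow> ennreal" where
  "var_x f = (\<integral>\<^sup>+x. ennreal ((x - mean_x f)\<^sup>2 * (cmod (f x))\<^sup>2) \<partial>lborel)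
     / ennreal ((L2_norm f)\<^sup>2)"

definition var_freq :: "(real \<Rightarrow> complex) \<Rightarrow> ennreal" where
  "var_freq f = (\<integral>\<^sup>+\<omega>. ennreal ((\<omega> - mean_freq f)\<^sup>2 * (cmod (fourier f \<omega>))\<^sup>2) \<partial>lborel)
     / ennreal (2 * pi * (L2_norm f)\<^sup>2)"

definition uncertainty :: "(real \<Rightarrow> complex) \<Rightarrow> ennreal" where
  "uncertainty f = var_x f * var_freq f"

end

theory Submission
  imports Defs "HOL-Probability.Probability" "HOL-Real_Asymp.Real_Asymp"
begin

text \<open>Write \<open>S u = sin u / u\<close>. The Fourier transform of \<open>rect_pow p\<close> is \<open>S (\<omega> / 2) ^ p\<close>, so Plancherel,
  applied to \<open>rect_pow p\<close> and to \<open>x * rect_pow p x\<close>, turns the uncertainty product into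
  \<open>p\<^sup>2 * (\<integral> S' u ^ 2 * S u ^ (2 p - 2)) * (\<integral> u\<^sup>2 * S u ^ (2 p)) / I\<^sup>2\<close> with \<open>I = \<integral> S u ^ (2 p)\<close>
  (\<open>uncertainty_crect_pow\<close>). Integration by parts gives \<open>\<integral> u * S' u * S u ^ (2 p - 1) = - I / (2 p)\<close>,
  and Lagrange's identity for this pair of integrals then shows that the uncertainty product is
  \<open>1 / 4 + p\<^sup>2 * D p / (2 * I\<^sup>2)\<close>, where \<open>D p\<close> is the integral over the plane of the nonnegative function
  \<open>Phi = (S' u * v * S v - S' v * u * S u)\<^sup>2 * (S u * S v) ^ (2 p - 2)\<close> (\<open>sc_uncertainty_eq\<close>). The main
  term \<open>1 / 4\<close> is gone, and only crude estimates are needed for the rest: \<open>D p\<close> decays about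
  like \<open>p powr - 5\<close>, whereas \<open>p\<^sup>2 / I\<^sup>2\<close> grows like \<open>p ^ 3\<close>.

  Upper bound for \<open>D (p + 1) / D p\<close> (\<open>integral_Phi_le\<close>). On the main lobe \<open>\<bar>u\<bar> < pi\<close> write
  \<open>S' u = - u * g u * S u\<close>. The integral over the square of the divergence of the field
  \<open>(u * Phi, v * Phi)\<close> is 0. As \<open>g\<close> and \<open>u * g' u - 2 * g u\<close> both increase with \<open>\<bar>u\<bar>\<close>, for the index \<open>p + 1\<close>
  this divergence is at least \<open>Phi * (10 - 2 * (p + 1) * s)\<close>, where \<open>s = u\<^sup>2 * g u + v\<^sup>2 * g v\<close>. So \<open>s\<close>
  is at least \<open>m = 5 / (p + 1)\<close> on average. Since \<open>1 / (S u * S v)\<^sup>2\<close> is at least \<open>1 + s + 2 / 5 * s\<^sup>2\<close>,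
  convexity gives a loss of at least the factor \<open>1 + m + 2 / 5 * m\<^sup>2\<close> on the square;
  outside of it the loss is at least a factor of 9.

  Lower bound for the ratio of the integrals \<open>I\<close> (\<open>sc_int_add2_ge\<close>). On the main lobe
  \<open>S u \<ge> 1 + u * S' u / (2 * S u)\<close>, and integration by parts yields a factor
  \<open>1 - 1 / (2 n)\<close> for passing from the exponent \<open>n\<close> to \<open>n + 1\<close>. The side lobes contribute at most
  the fraction \<open>1 / (30 p)\<close> of the main lobe. A polynomial inequality in \<open>p\<close> combines the two bounds.\<close>

section \<open>The sinc function and its derivative\<close>

text \<open>The library's \<^term>\<open>sinc\<close> is an abbreviation; a constant of its own keeps the case distinction at 0
  from being unfolded by the simplifier.\<close>

definition sc :: "real \<Rightarrow> real" where
  "sc u = sinc u"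

text \<open>The derivative of \<^const>\<open>sc\<close>, extended continuously by 0 at the origin.\<close>

definition dsc :: "real \<Rightarrow> real" where
  "dsc u = (if u = 0 then 0 else (cos u - sc u) / u)"

lemma mult_sc: "u * sc u = sin u"
  by (simp add: sc_def)

lemma mult_dsc: "u * dsc u = cos u - sc u"
  by (simp add: sc_def dsc_def)

lemma sc_minus [simp]: "sc (- u) = sc u"
  by (simp add: sc_def)

lemma dsc_minus [simp]: "dsc (- u) = - dsc u"
  by (simp add: dsc_def divide_simps)

lemma isCont_sc: "isCont sc u"
  using isCont_sinc[of u] unfolding sc_def[abs_def] .

lemma isCont_dsc: "isCont dsc u"
proof (cases "u = 0")
  case True
  have "((\<lambda>u::real. (cos u - sin u / u) / u) \<longlongrightarrow> 0) (at 0)" by real_asymp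
  then have "(dsc \<longlongrightarrow> 0) (at 0)"
    by (rule Lim_transform_eventually) (auto simp: eventually_at_filter sc_def dsc_def)
  then show ?thesis by (simp add: True isCont_def dsc_def)
next
  case False
  have "isCont (\<lambda>u. (cos u - sc u) / u) u"
    using False by (intro continuous_intros isCont_sc) auto
  moreover have "eventually (\<lambda>x. x \<noteq> 0) (nhds u)"
    using False by (intro t1_space_nhds) auto
  then have "eventually (\<lambda>x. dsc x = (cos x - sc x) / x) (nhds u)"
    by (rule eventually_mono) (simp add: dsc_def)
  ultimately show ?thesis by (simp cong: isCont_cong)
qed

lemma continuous_on_sc [continuous_intros]:
  "continuous_on A f \<Longrightarrow> continuous_on A (\<lambda>x. sc (f x))"
  using continuous_on_compose2[of UNIV sc A f] isCont_sc
  by (simp add: continuous_at_imp_continuous_on)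

lemma continuous_on_dsc [continuous_intros]:
  "continuous_on A f \<Longrightarrow> continuous_on A (\<lambda>x. dsc (f x))"
  using continuous_on_compose2[of UNIV dsc A f] isCont_dsc
  by (simp add: continuous_at_imp_continuous_on)

lemma borel_measurable_sc [measurable]: "sc \<in> borel_measurable borel"
  by (intro borel_measurable_continuous_onI continuous_intros)

lemma borel_measurable_dsc [measurable]: "dsc \<in> borel_measurable borel"
  by (intro borel_measurable_continuous_onI continuous_intros)

lemma DERIV_sc:
  assumes "u \<noteq> 0"
  shows "(sc has_real_derivative dsc u) (at u)"
proof -
  have "((\<lambda>u. sin u / u) has_real_derivative dsc u) (at u)"
    using assms by (auto intro!: derivative_eq_intros simp: dsc_def sc_def field_simps)
  then show ?thesis
    by (rule has_field_derivative_transform_within_open[where S = "- {0}"])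
       (use assms in \<open>auto simp: sc_def\<close>)
qed

text \<open>The differential equation \<open>u * S'' + 2 * S' + u * S = 0\<close>. It expresses the dilation derivative
  \<open>u * S''\<close> by \<open>S\<close> and \<open>S'\<close>, so that the divergence below is visibly continuous.\<close>

lemma DERIV_dsc:
  assumes "u \<noteq> 0"
  shows "(dsc has_real_derivative (- 2 * dsc u - u * sc u) / u) (at u)"
proof -
  have "((\<lambda>u. (cos u - sc u) / u) has_real_derivative (- 2 * dsc u - u * sc u) / u) (at u)"
    using assms
    by (auto intro!: derivative_eq_intros DERIV_sc simp: mult_sc)
       (simp add: dsc_def sc_def field_simps)
  then show ?thesis
    by (rule has_field_derivative_transform_within_open[where S = "- {0}"])
       (use assms in \<open>auto simp: dsc_def\<close>)
qed

lemma abs_mult_sc_le: "\<bar>u * sc u\<bar> \<le> 1"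
  by (simp add: mult_sc)

lemma abs_sc_le: "\<bar>sc u\<bar> \<le> 1"
  using abs_sin_x_le_abs_x[of u] by (simp add: sc_def)

lemma abs_mult_dsc_le: "\<bar>u * dsc u\<bar> \<le> 2"
  using abs_sc_le[of u] abs_cos_le_one[of u] unfolding mult_dsc by linarith

lemma sc_pos: "\<bar>u\<bar> < pi \<Longrightarrow> 0 < sc u"
  using sin_gt_zero[of u] sin_gt_zero[of "- u"]
  by (cases "u = 0"; cases "0 < u") (auto simp: sc_def zero_less_divide_iff)

section \<open>Pointwise inequalities on the main lobe\<close>

lemma nonneg_if_deriv_nonneg:
  fixes f f' :: "real \<Rightarrow> real"
  assumes x: "0 < x"
    and der: "\<And>t. 0 < t \<Longrightarrow> t \<le> x \<Longrightarrow> (f has_real_derivative f' t) (at t)"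
    and nn: "\<And>t. 0 < t \<Longrightarrow> t \<le> x \<Longrightarrow> 0 \<le> f' t"
    and lim: "(f \<longlongrightarrow> 0) (at_right 0)"
  shows "0 \<le> f x"
proof (rule tendsto_upperbound[OF lim])
  have "eventually (\<lambda>t. t \<in> {0<..<x}) (at_right 0)"
    using x by (rule eventually_at_right_real)
  then show "eventually (\<lambda>t. f t \<le> f x) (at_right 0)"
  proof eventually_elim
    case (elim t)
    then show ?case
      by (intro DERIV_nonneg_imp_nondecreasing[of t x f]) (auto intro!: exI der nn)
  qed
qed simp

lemma cos_mult_cos:
  fixes x y :: real
  shows "cos x * cos x = 1 - sin x * sin x" "cos x * (cos x * y) = y - sin x * (sin x * y)"
proof -
  show c: "cos x * cos x = 1 - sin x * sin x"
    using sin_cos_squared_add[of x] by (simp add: power2_eq_square)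
  show "cos x * (cos x * y) = y - sin x * (sin x * y)"
    by (simp add: c left_diff_distrib flip: mult.assoc)
qed

lemma sin_ge_mult_cos:
  fixes u :: real
  assumes "0 < u" "u < pi"
  shows "0 \<le> sin u - u * cos u"
proof (rule nonneg_if_deriv_nonneg[OF assms(1), where f' = "\<lambda>u. u * sin u"])
  show "((\<lambda>u::real. sin u - u * cos u) \<longlongrightarrow> 0) (at_right 0)" by real_asymp
  show "0 \<le> t * sin t" if "0 < t" "t \<le> u" for t
    using that assms by (intro mult_nonneg_nonneg sin_ge_zero) auto
qed (auto intro!: derivative_eq_intros)

text \<open>The function \<open>g\<close> with \<open>S' u = - u * g u * S u\<close> on the main lobe; \<open>1 / 3\<close> is its limit at 0. It
  satisfies the Riccati equation \<open>u * g' u = 1 - 3 * g u + u\<^sup>2 * (g u)\<^sup>2\<close>.\<close>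

definition log_slope :: "real \<Rightarrow> real" where
  "log_slope u = (if u = 0 then 1 / 3 else (1 - u * cos u / sin u) / u\<^sup>2)"

text \<open>By the Riccati equation this is \<open>u * g' u - 2 * g u\<close>. With \<open>y = u\<^sup>2\<close>, \<open>g = G y\<close>, its derivative is
  \<open>4 * u ^ 3 * G'' y\<close>; so it is monotone because \<open>G\<close> is convex.\<close>

definition slope_gap :: "real \<Rightarrow> real" where
  "slope_gap u = 1 - 5 * log_slope u + u\<^sup>2 * (log_slope u)\<^sup>2"

lemma log_slope_minus [simp]: "log_slope (- u) = log_slope u"
  by (simp add: log_slope_def)

lemma slope_gap_minus [simp]: "slope_gap (- u) = slope_gap u"
  by (simp add: slope_gap_def)

lemma dsc_eq_log_slope:
  assumes "\<bar>u\<bar> < pi"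
  shows "dsc u = - u * log_slope u * sc u"
proof (cases "u = 0")
  case False
  then have "sin u \<noteq> 0"
    using assms sc_pos[of u] by (auto simp: sc_def)
  then show ?thesis using False
    by (simp add: dsc_def log_slope_def sc_def field_simps power2_eq_square)
qed (simp add: dsc_def)

lemma isCont_log_slope:
  assumes "\<bar>u\<bar> < pi"
  shows "isCont log_slope u"
proof (cases "u = 0")
  case True
  have "((\<lambda>u::real. (1 - u * cos u / sin u) / u\<^sup>2) \<longlongrightarrow> 1 / 3) (at 0)" by real_asymp
  then have "(log_slope \<longlongrightarrow> 1 / 3) (at 0)"
    by (rule Lim_transform_eventually) (auto simp: eventually_at_filter log_slope_def)
  then show ?thesis by (simp add: True isCont_def log_slope_def)
next
  case False
  then have "sin u \<noteq> 0"
    using assms sc_pos[of u] by (auto simp: sc_def)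
  then have "isCont (\<lambda>u. (1 - u * cos u / sin u) / u\<^sup>2) u"
    using False by (intro continuous_intros) auto
  moreover have "eventually (\<lambda>x. x \<noteq> 0) (nhds u)"
    using False by (intro t1_space_nhds) auto
  then have "eventually (\<lambda>x. log_slope x = (1 - x * cos x / sin x) / x\<^sup>2) (nhds u)"
    by (rule eventually_mono) (simp add: log_slope_def)
  ultimately show ?thesis by (simp cong: isCont_cong)
qed

lemma isCont_slope_gap: "\<bar>u\<bar> < pi \<Longrightarrow> isCont slope_gap u"
  unfolding slope_gap_def[abs_def] by (intro continuous_intros isCont_log_slope)

lemma DERIV_log_slope:
  assumes "0 < u" "u < pi"
  shows "(log_slope has_real_derivative (u\<^sup>2 - 2 * (sin u)\<^sup>2 + u * sin u * cos u) / (u ^ 3 * (sin u)\<^sup>2)) (at u)"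
proof -
  have s: "sin u > 0" using assms by (rule sin_gt_zero)
  have "((\<lambda>u. (1 - u * cos u / sin u) / u\<^sup>2) has_real_derivative
     (u\<^sup>2 - 2 * (sin u)\<^sup>2 + u * sin u * cos u) / (u ^ 3 * (sin u)\<^sup>2)) (at u)"
    using assms s
    by (auto intro!: derivative_eq_intros)
       (simp add: field_simps eval_nat_numeral cos_mult_cos)
  then show ?thesis
    by (rule has_field_derivative_transform_within_open[where S = "- {0}"])
       (use assms in \<open>auto simp: log_slope_def\<close>)
qed

text \<open>The numerator of the derivative of \<^const>\<open>log_slope\<close>.\<close>

lemma trig_ineq_log_slope:
  fixes u :: real
  assumes "0 < u" "u < pi"
  shows "0 \<le> u\<^sup>2 - 2 * (sin u)\<^sup>2 + u * sin u * cos u"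
proof (rule nonneg_if_deriv_nonneg[OF assms(1),
    where f' = "\<lambda>u. 2 * u - 3 * sin u * cos u + u * ((cos u)\<^sup>2 - (sin u)\<^sup>2)"])
  show "((\<lambda>u::real. u\<^sup>2 - 2 * (sin u)\<^sup>2 + u * sin u * cos u) \<longlongrightarrow> 0) (at_right 0)" by real_asymp
  fix t :: real assume t: "0 < t" "t \<le> u"
  show "0 \<le> 2 * t - 3 * sin t * cos t + t * ((cos t)\<^sup>2 - (sin t)\<^sup>2)"
  proof (rule nonneg_if_deriv_nonneg[OF t(1), where f' = "\<lambda>u. 4 * sin u * (sin u - u * cos u)"])
    show "((\<lambda>t::real. 2 * t - 3 * sin t * cos t + t * ((cos t)\<^sup>2 - (sin t)\<^sup>2)) \<longlongrightarrow> 0) (at_right 0)"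
      by real_asymp
    fix x :: real assume x: "0 < x" "x \<le> t"
    show "0 \<le> 4 * sin x * (sin x - x * cos x)"
      using x t assms sin_ge_mult_cos[of x] sin_gt_zero[of x] by (intro mult_nonneg_nonneg) auto
    show "((\<lambda>t. 2 * t - 3 * sin t * cos t + t * ((cos t)\<^sup>2 - (sin t)\<^sup>2)) has_real_derivative
        4 * sin x * (sin x - x * cos x)) (at x)"
      by (auto intro!: derivative_eq_intros) (simp add: algebra_simps power2_eq_square cos_mult_cos)
  qed
qed (auto intro!: derivative_eq_intros simp: algebra_simps power2_eq_square)

lemma log_slope_mono:
  assumes "0 \<le> u" "u \<le> v" "v < pi"
  shows "log_slope u \<le> log_slope v"
proof (cases "u = v")
  case False
  show ?thesis
  proof (rule DERIV_nonneg_imp_increasing_open[of u v log_slope])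
    show "u \<le> v" by fact
    show "continuous_on {u..v} log_slope"
      using assms by (intro continuous_at_imp_continuous_on ballI isCont_log_slope) auto
    show "\<exists>y. (log_slope has_real_derivative y) (at x) \<and> 0 \<le> y" if "u < x" "x < v" for x
      using that assms
      by (intro exI[of _ "(x\<^sup>2 - 2 * (sin x)\<^sup>2 + x * sin x * cos x) / (x ^ 3 * (sin x)\<^sup>2)"]
            conjI DERIV_log_slope divide_nonneg_nonneg trig_ineq_log_slope) auto
  qed
qed simp

lemma log_slope_ge: "\<bar>u\<bar> < pi \<Longrightarrow> 1 / 3 \<le> log_slope u"
  using log_slope_mono[of 0 "\<bar>u\<bar>"] by (cases "0 \<le> u") (auto simp: log_slope_def)

text \<open>Differentiating the Riccati equation of \<open>G\<close> twice gives
  \<open>2 * y * G''' + (7 - 2 * y * G) * G'' = 4 * G * G' + 2 * y * G' ^ 2\<close>. The left-hand side of the claim is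
  \<open>4 * u ^ 7 * (sc u)\<^sup>2 * G'' (u\<^sup>2)\<close>, that is, \<open>G''\<close> times an integrating factor of this equation. So its
  derivative comes from \<open>G\<close> and \<open>G'\<close>, whose signs are the two trigonometric inequalities proved above.\<close>

lemma trig_ineq_slope_gap:
  fixes u :: real
  assumes "0 < u" "u < pi"
  shows "0 \<le> 8 * (sin u)\<^sup>2 / u - 3 * sin u * cos u - 3 * u - 2 * u\<^sup>2 * cos u / sin u"
proof (rule nonneg_if_deriv_nonneg[OF assms(1), where
    f' = "\<lambda>u. 2 * (u\<^sup>2 - 2 * (sin u)\<^sup>2 + u * sin u * cos u) *
       (4 * sin u * (sin u - u * cos u) + (u\<^sup>2 - 2 * (sin u)\<^sup>2 + u * sin u * cos u)) / (u * sin u)\<^sup>2"])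
  show "((\<lambda>u::real. 8 * (sin u)\<^sup>2 / u - 3 * sin u * cos u - 3 * u - 2 * u\<^sup>2 * cos u / sin u)
     \<longlongrightarrow> 0) (at_right 0)" by real_asymp
  fix t :: real assume t: "0 < t" "t \<le> u"
  have s: "sin t > 0" using t assms by (intro sin_gt_zero) auto
  have nn: "0 \<le> 2 * b * (4 * sin t * d + b) / (t * sin t)\<^sup>2" if "0 \<le> b" "0 \<le> d" for b d :: real
    using that s by (intro divide_nonneg_nonneg mult_nonneg_nonneg add_nonneg_nonneg) auto
  show "0 \<le> 2 * (t\<^sup>2 - 2 * (sin t)\<^sup>2 + t * sin t * cos t) *
       (4 * sin t * (sin t - t * cos t) + (t\<^sup>2 - 2 * (sin t)\<^sup>2 + t * sin t * cos t)) / (t * sin t)\<^sup>2"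
    using t assms by (intro nn trig_ineq_log_slope sin_ge_mult_cos) auto
  show "((\<lambda>u. 8 * (sin u)\<^sup>2 / u - 3 * sin u * cos u - 3 * u - 2 * u\<^sup>2 * cos u / sin u)
      has_real_derivative 2 * (t\<^sup>2 - 2 * (sin t)\<^sup>2 + t * sin t * cos t) *
       (4 * sin t * (sin t - t * cos t) + (t\<^sup>2 - 2 * (sin t)\<^sup>2 + t * sin t * cos t)) / (t * sin t)\<^sup>2) (at t)"
    using t s
    by (auto intro!: derivative_eq_intros)
       (simp add: field_simps power2_eq_square cos_mult_cos)
qed

lemma slope_gap_mono:
  assumes "0 \<le> u" "u \<le> v" "v < pi"
  shows "slope_gap u \<le> slope_gap v"
proof (cases "u = v")
  case False
  show ?thesis
  proof (rule DERIV_nonneg_imp_increasing_open[of u v slope_gap])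
    show "u \<le> v" by fact
    show "continuous_on {u..v} slope_gap"
      using assms by (intro continuous_at_imp_continuous_on ballI isCont_slope_gap) auto
    fix x assume "u < x" "x < v"
    then have x: "0 < x" "x < pi" using assms by auto
    have s: "sin x > 0" using x by (rule sin_gt_zero)
    define F where "F = 8 * (sin x)\<^sup>2 / x - 3 * sin x * cos x - 3 * x - 2 * x\<^sup>2 * cos x / sin x"
    have "(slope_gap has_real_derivative F / (x\<^sup>2 * (sin x)\<^sup>2)) (at x)"
      unfolding slope_gap_def[abs_def] F_def using x s
      by (auto intro!: derivative_eq_intros DERIV_log_slope)
         (simp add: log_slope_def divide_simps, simp add: algebra_simps eval_nat_numeral cos_mult_cos)
    moreover have "0 \<le> F / (x\<^sup>2 * (sin x)\<^sup>2)"
      unfolding F_def using trig_ineq_slope_gap[OF x] by (intro divide_nonneg_nonneg) auto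
    ultimately show "\<exists>y. (slope_gap has_real_derivative y) (at x) \<and> 0 \<le> y" by blast
  qed
qed simp

lemma slope_gap_ge: "\<bar>u\<bar> < pi \<Longrightarrow> - 2 / 3 \<le> slope_gap u"
  using slope_gap_mono[of 0 "\<bar>u\<bar>"] by (cases "0 \<le> u") (auto simp: slope_gap_def log_slope_def)

text \<open>Divided by \<open>2 * S u\<close>, this is \<open>S u \<ge> 1 - u\<^sup>2 * g u / 2\<close>.\<close>

lemma sc_quadratic_ineq:
  assumes "\<bar>u\<bar> \<le> pi"
  shows "0 \<le> 2 * (sc u)\<^sup>2 - 2 * sc u - u * dsc u"
proof -
  have pos: "0 \<le> 2 * (sc u)\<^sup>2 - 2 * sc u - u * dsc u" if u: "0 < u" "u < pi" for u
  proof -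
    have s: "sin u > 0" using u by (rule sin_gt_zero)
    have "0 \<le> 2 * sin u - u - u\<^sup>2 * cos u / sin u"
    proof (rule nonneg_if_deriv_nonneg[OF u(1), where
        f' = "\<lambda>u. (u / sin u - 1) * (u / sin u + 1 - 2 * cos u)"])
      show "((\<lambda>u::real. 2 * sin u - u - u\<^sup>2 * cos u / sin u) \<longlongrightarrow> 0) (at_right 0)" by real_asymp
      fix t :: real assume t: "0 < t" "t \<le> u"
      have st: "sin t > 0" using t u by (intro sin_gt_zero) auto
      have "1 \<le> t / sin t" using sin_x_le_x[of t] t st by (simp add: field_simps)
      then show "0 \<le> (t / sin t - 1) * (t / sin t + 1 - 2 * cos t)"
        using cos_le_one[of t] by (intro mult_nonneg_nonneg) linarith+
      show "((\<lambda>u. 2 * sin u - u - u\<^sup>2 * cos u / sin u) has_real_derivative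
          (t / sin t - 1) * (t / sin t + 1 - 2 * cos t)) (at t)"
        using t st by (auto intro!: derivative_eq_intros)
          (simp add: divide_simps, simp add: algebra_simps power2_eq_square cos_mult_cos)
    qed
    then have "0 \<le> sin u * (2 * sin u - u - u\<^sup>2 * cos u / sin u) / u\<^sup>2"
      using s by (intro divide_nonneg_nonneg mult_nonneg_nonneg) auto
    also have "\<dots> = 2 * (sc u)\<^sup>2 - 2 * sc u - u * dsc u"
      using s u by (simp add: sc_def dsc_def field_simps power2_eq_square)
    finally show ?thesis .
  qed
  consider "u = 0" | "u = pi" | "u = - pi" | "0 < \<bar>u\<bar>" "\<bar>u\<bar> < pi" using assms by linarith
  then show ?thesis
  proof cases
    case 4
    then show ?thesis using pos[of "\<bar>u\<bar>"] by (cases "0 \<le> u") auto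
  qed (auto simp: mult_dsc sc_def)
qed

section \<open>A divergence estimate on the square of the main lobe\<close>

text \<open>The determinant formed by the values of \<open>S'\<close> and \<open>u * S\<close> at two points.\<close>

definition wedge :: "real \<Rightarrow> real \<Rightarrow> real" where
  "wedge u v = dsc u * (v * sc v) - dsc v * (u * sc u)"

text \<open>The integrand of \<open>D p\<close>, for \<open>n = 2 * p - 2\<close>.\<close>

definition Phi :: "nat \<Rightarrow> real \<Rightarrow> real \<Rightarrow> real" where
  "Phi n u v = (wedge u v)\<^sup>2 * (sc u * sc v) ^ n"

text \<open>The partial derivative of \<open>u * Phi n u v\<close> in \<open>u\<close>. The second derivative of sinc has been eliminated by
  its differential equation.\<close>

definition dPhi :: "nat \<Rightarrow> real \<Rightarrow> real \<Rightarrow> real" where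
  "dPhi n u v = Phi n u v
     + 2 * wedge u v * ((- 2 * dsc u - u * sc u) * (v * sc v) - dsc v * (u * (sc u + u * dsc u)))
         * (sc u * sc v) ^ n
     + real n * (wedge u v)\<^sup>2 * (sc u * sc v) ^ (n - 1) * (u * dsc u * sc v)"

lemma wedge_swap: "wedge v u = - wedge u v"
  by (simp add: wedge_def)

lemma Phi_swap: "Phi n v u = Phi n u v"
  by (simp add: Phi_def wedge_swap[of v u] mult.commute)

lemma Phi_add2: "Phi (n + 2) u v = Phi n u v * (sc u * sc v)\<^sup>2"
  unfolding Phi_def power_add by simp

lemma Phi_nonneg: "even n \<Longrightarrow> 0 \<le> Phi n u v"
  by (simp add: Phi_def zero_le_even_power)

lemma continuous_on_wedge [continuous_intros]:
  "continuous_on A f \<Longrightarrow> continuous_on A g \<Longrightarrow> continuous_on A (\<lambda>x. wedge (f x) (g x))"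
  unfolding wedge_def by (intro continuous_intros)

lemma continuous_on_Phi [continuous_intros]:
  "continuous_on A f \<Longrightarrow> continuous_on A g \<Longrightarrow> continuous_on A (\<lambda>x. Phi n (f x) (g x))"
  unfolding Phi_def by (intro continuous_intros)

lemma continuous_on_dPhi [continuous_intros]:
  "continuous_on A f \<Longrightarrow> continuous_on A g \<Longrightarrow> continuous_on A (\<lambda>x. dPhi n (f x) (g x))"
  unfolding dPhi_def by (intro continuous_intros)

lemma DERIV_mult_Phi:
  assumes "u \<noteq> 0"
  shows "((\<lambda>u. u * Phi n u v) has_real_derivative dPhi n u v) (at u)"
proof -
  have *: "u * ((- 2 * dsc u - u * sc u) / u * (v * sc v) - dsc v * (sc u + u * dsc u))
    = (- 2 * dsc u - u * sc u) * (v * sc v) - dsc v * (u * (sc u + u * dsc u))"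
    using assms by (simp add: field_simps)
  have "((\<lambda>u. wedge u v) has_real_derivative
      (- 2 * dsc u - u * sc u) / u * (v * sc v) - dsc v * (sc u + u * dsc u)) (at u)"
    unfolding wedge_def using assms
    by (auto intro!: derivative_eq_intros DERIV_sc DERIV_dsc simp del: minus_mult_left[symmetric])
  note wedge = this
  have "((\<lambda>u. u * ((wedge u v)\<^sup>2 * (sc u * sc v) ^ n)) has_real_derivative
      Phi n u v + u * (2 * wedge u v * ((- 2 * dsc u - u * sc u) / u * (v * sc v) - dsc v * (sc u + u * dsc u)) * (sc u * sc v) ^ n
      + (wedge u v)\<^sup>2 * (real n * (sc u * sc v) ^ (n - 1) * (dsc u * sc v)))) (at u)"
    using assms
    by (auto intro!: derivative_eq_intros wedge DERIV_sc simp: Phi_def simp del: power_mult_distrib)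
  moreover have "Phi n u v + u * (2 * wedge u v * ((- 2 * dsc u - u * sc u) / u * (v * sc v) - dsc v * (sc u + u * dsc u)) * (sc u * sc v) ^ n
      + (wedge u v)\<^sup>2 * (real n * (sc u * sc v) ^ (n - 1) * (dsc u * sc v))) = dPhi n u v"
    unfolding dPhi_def *[symmetric] by algebra
  ultimately show ?thesis unfolding Phi_def by simp
qed

lemma has_integral_dPhi:
  assumes "0 < n"
  shows "((\<lambda>u. dPhi n u v) has_integral 0) {- pi..pi}"
proof -
  have "((\<lambda>u. dPhi n u v) has_integral (pi * Phi n pi v - (- pi) * Phi n (- pi) v)) {- pi..pi}"
    by (rule fundamental_theorem_of_calculus_interior_strong[of "{0}"])
       (auto intro!: continuous_intros DERIV_mult_Phi simp flip: has_real_derivative_iff_has_vector_derivative)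
  moreover have "Phi n pi v = 0" "Phi n (- pi) v = 0"
    using assms by (auto simp: Phi_def sc_def)
  ultimately show ?thesis by simp
qed

lemma sc_log_slope_identity:
  assumes "\<bar>u\<bar> < pi"
  shows "(sc u)\<^sup>2 * (u\<^sup>2 + (1 - u\<^sup>2 * log_slope u)\<^sup>2) = 1"
proof -
  have "cos u = sc u - u\<^sup>2 * log_slope u * sc u"
    using mult_dsc[of u] dsc_eq_log_slope[OF assms] by (simp add: power2_eq_square algebra_simps)
  then have "1 = (u * sc u)\<^sup>2 + (sc u - u\<^sup>2 * log_slope u * sc u)\<^sup>2"
    using sin_cos_squared_add[of u] by (simp add: mult_sc)
  also have "\<dots> = (sc u)\<^sup>2 * (u\<^sup>2 + (1 - u\<^sup>2 * log_slope u)\<^sup>2)"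
    by algebra
  finally show ?thesis ..
qed

text \<open>Equivalently \<open>1 / (S u)\<^sup>2 \<ge> 1 + a + 2 / 5 * a\<^sup>2\<close> for \<open>a = u\<^sup>2 * g u\<close>. By the identity
  above, \<open>1 / (S u)\<^sup>2 = u\<^sup>2 + (1 - a)\<^sup>2\<close>, so this is the bound \<open>- 2 / 3\<close> for \<^const>\<open>slope_gap\<close>. The
  coefficient \<open>2 / 5\<close> is the best one at \<open>u = 0\<close>.\<close>

lemma sc_square_le:
  assumes "\<bar>u\<bar> < pi"
  shows "(sc u)\<^sup>2 * (1 + u\<^sup>2 * log_slope u + 2 / 5 * (u\<^sup>2 * log_slope u)\<^sup>2) \<le> 1"
proof -
  have "0 \<le> u\<^sup>2 * (3 / 5 * (slope_gap u + 2 / 3))"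
    using slope_gap_ge[OF assms] by simp
  then have "1 + u\<^sup>2 * log_slope u + 2 / 5 * (u\<^sup>2 * log_slope u)\<^sup>2 \<le> u\<^sup>2 + (1 - u\<^sup>2 * log_slope u)\<^sup>2"
    unfolding slope_gap_def by (simp add: algebra_simps power2_eq_square)
  then have "(sc u)\<^sup>2 * (1 + u\<^sup>2 * log_slope u + 2 / 5 * (u\<^sup>2 * log_slope u)\<^sup>2) \<le> (sc u)\<^sup>2 * (u\<^sup>2 + (1 - u\<^sup>2 * log_slope u)\<^sup>2)"
    by (intro mult_left_mono) auto
  then show ?thesis using sc_log_slope_identity[OF assms] by simp
qed

lemma log_slope_slope_gap_comonotone:
  assumes "\<bar>u\<bar> < pi" "\<bar>v\<bar> < pi"
  shows "0 \<le> (log_slope v - log_slope u) * (slope_gap v - slope_gap u)"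
proof -
  have abs: "log_slope \<bar>x\<bar> = log_slope x" "slope_gap \<bar>x\<bar> = slope_gap x" for x
    by (simp_all add: abs_if)
  show ?thesis
    using log_slope_mono[of "\<bar>u\<bar>" "\<bar>v\<bar>"] slope_gap_mono[of "\<bar>u\<bar>" "\<bar>v\<bar>"]
      log_slope_mono[of "\<bar>v\<bar>" "\<bar>u\<bar>"] slope_gap_mono[of "\<bar>v\<bar>" "\<bar>u\<bar>"] assms
    unfolding abs by (cases "\<bar>u\<bar> \<le> \<bar>v\<bar>") (auto intro: mult_nonneg_nonneg mult_nonpos_nonpos)
qed

text \<open>The divergence of \<open>(u * Phi, v * Phi)\<close>: the factor \<open>(S u * S v) ^ n\<close> contributes \<open>- n * s\<close> with
  \<open>s = u\<^sup>2 * g u + v\<^sup>2 * g v\<close>, the dimension 2, and the square of the wedge, which is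
  \<open>(u * v * S u * S v * (g v - g u))\<^sup>2\<close>, at least \<open>4 - 2 * s\<close> from the first four factors and 4 from
  \<open>g v - g u\<close>, since \<open>g\<close> is convex in \<open>u\<^sup>2\<close>.\<close>

lemma div_Phi_ge:
  assumes u: "\<bar>u\<bar> < pi" and v: "\<bar>v\<bar> < pi" and n: "even n" "0 < n"
  shows "Phi n u v * (10 - real (n + 2) * (u\<^sup>2 * log_slope u + v\<^sup>2 * log_slope v)) \<le> dPhi n u v + dPhi n v u"
proof -
  define g h S T a b where "g = log_slope u" and "h = log_slope v" and "S = sc u" and "T = sc v"
    and "a = u\<^sup>2 * g" and "b = v\<^sup>2 * h"
  note defs = g_def h_def S_def T_def
  have dS: "dsc u = - u * g * S" and dT: "dsc v = - v * h * T"
    using dsc_eq_log_slope u v by (auto simp: defs)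
  have e: "wedge u v = u * v * S * T * (h - g)"
    unfolding wedge_def dS dT by (simp add: defs algebra_simps)
  define w where "w = u * v * S * T"
  have S1: "(S * T) ^ (n - 1) * (S * T) = (S * T) ^ n"
    using n by (metis power_minus_mult)
  \<comment> \<open>The dilation derivative of the wedge.\<close>
  have "((- 2 * dsc u - u * S) * (v * T) - dsc v * (u * (S + u * dsc u)))
      + ((- 2 * dsc v - v * T) * (u * S) - dsc u * (v * (T + v * dsc v))) * (- 1)
    = w * ((4 - a - b) * (h - g) + (slope_gap v - slope_gap u))"
    unfolding dS dT w_def a_def b_def slope_gap_def g_def[symmetric] h_def[symmetric] by algebra
  note E = this
  have "dPhi n u v + dPhi n v u = 2 * Phi n u v
     + 2 * wedge u v * (((- 2 * dsc u - u * S) * (v * T) - dsc v * (u * (S + u * dsc u)))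
      + ((- 2 * dsc v - v * T) * (u * S) - dsc u * (v * (T + v * dsc v))) * (- 1)) * (S * T) ^ n
     + real n * (wedge u v)\<^sup>2 * (S * T) ^ (n - 1) * (u * dsc u * T + v * dsc v * S)"
    unfolding dPhi_def Phi_swap[of n v u] wedge_swap[of v u] S_def[symmetric] T_def[symmetric]
    by (simp add: algebra_simps)
  also have "u * dsc u * T + v * dsc v * S = (S * T) * (- (a + b))"
    unfolding dS dT a_def b_def by algebra
  also have "real n * (wedge u v)\<^sup>2 * (S * T) ^ (n - 1) * ((S * T) * (- (a + b)))
     = Phi n u v * (- real n * (a + b))"
    unfolding Phi_def S1[symmetric] S_def[symmetric] T_def[symmetric] by (simp add: algebra_simps)
  also have "2 * wedge u v * (((- 2 * dsc u - u * S) * (v * T) - dsc v * (u * (S + u * dsc u)))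
      + ((- 2 * dsc v - v * T) * (u * S) - dsc u * (v * (T + v * dsc v))) * (- 1)) * (S * T) ^ n
      = Phi n u v * (2 * (4 - a - b)) + 2 * (w\<^sup>2 * ((h - g) * (slope_gap v - slope_gap u)) * (S * T) ^ n)"
    unfolding E Phi_def S_def[symmetric] T_def[symmetric] e w_def by (simp add: algebra_simps power2_eq_square)
  finally have "dPhi n u v + dPhi n v u - Phi n u v * (10 - real (n + 2) * (a + b))
      = 2 * (w\<^sup>2 * ((h - g) * (slope_gap v - slope_gap u)) * (S * T) ^ n)"
    by (simp add: algebra_simps)
  moreover have "0 \<le> w\<^sup>2 * ((h - g) * (slope_gap v - slope_gap u)) * (S * T) ^ n"
    using mult_nonneg_nonneg[OF mult_nonneg_nonneg[OF zero_le_power2 log_slope_slope_gap_comonotone[OF u v]]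
        zero_le_even_power[OF n(1)]]
    unfolding g_def h_def by simp
  ultimately show ?thesis by (simp add: a_def b_def defs)
qed

text \<open>The pointwise form of the recursion for \<open>D\<close>. It avoids the integrals of \<open>s * Phi\<close>: the quadratic in \<open>s\<close>
  is replaced by its tangent at the value \<open>m\<close> which bounds the mean of \<open>s\<close> from below, and the linear term
  is bounded by the divergence, whose integral vanishes.\<close>

lemma Phi_main_lobe_le:
  fixes n :: nat and u v :: real
  assumes u: "\<bar>u\<bar> \<le> pi" and v: "\<bar>v\<bar> \<le> pi" and n: "even n"
  defines "m \<equiv> 10 / real (n + 4)"
  shows "(1 + m + 2 / 5 * m\<^sup>2) * Phi (n + 2) u v
      - (1 + 4 / 5 * m) / real (n + 4) * (dPhi (n + 2) u v + dPhi (n + 2) v u) \<le> Phi n u v"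
proof (cases "\<bar>u\<bar> < pi \<and> \<bar>v\<bar> < pi")
  case True
  define a b s P D where "a = u\<^sup>2 * log_slope u" and "b = v\<^sup>2 * log_slope v" and "s = a + b"
    and "P = Phi (n + 2) u v" and "D = dPhi (n + 2) u v + dPhi (n + 2) v u"
  have a0: "0 \<le> a" and b0: "0 \<le> b"
    using log_slope_ge[of u] log_slope_ge[of v] True unfolding a_def b_def
    by (auto intro!: mult_nonneg_nonneg)
  have P0: "0 \<le> P" unfolding P_def using n by (intro Phi_nonneg) auto
  have D: "P * (10 - real (n + 4) * s) \<le> D"
    using div_Phi_ge[of u v "n + 2"] True n by (simp add: P_def D_def s_def a_def b_def add.commute)
  have "(sc u * sc v)\<^sup>2 * (1 + s + 2 / 5 * s\<^sup>2)
     \<le> (sc u * sc v)\<^sup>2 * ((1 + a + 2 / 5 * a\<^sup>2) * (1 + b + 2 / 5 * b\<^sup>2))"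
  proof (intro mult_left_mono)
    have "(1 + a + 2 / 5 * a\<^sup>2) * (1 + b + 2 / 5 * b\<^sup>2)
      = 1 + s + 2 / 5 * s\<^sup>2 + (1 / 5 * (a * b) + 2 / 5 * (a * b\<^sup>2) + 2 / 5 * (a\<^sup>2 * b) + 4 / 25 * (a\<^sup>2 * b\<^sup>2))"
      by (simp add: s_def algebra_simps power2_eq_square)
    then show "1 + s + 2 / 5 * s\<^sup>2 \<le> (1 + a + 2 / 5 * a\<^sup>2) * (1 + b + 2 / 5 * b\<^sup>2)"
      using a0 b0 by simp
  qed simp
  also have "\<dots> = ((sc u)\<^sup>2 * (1 + a + 2 / 5 * a\<^sup>2)) * ((sc v)\<^sup>2 * (1 + b + 2 / 5 * b\<^sup>2))"
    by (simp add: power_mult_distrib)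
  also have "\<dots> \<le> 1"
    using True a0 b0
    by (intro mult_le_one[OF sc_square_le[of u, folded a_def] _ sc_square_le[of v, folded b_def]]) auto
  finally have "Phi n u v * ((sc u * sc v)\<^sup>2 * (1 + s + 2 / 5 * s\<^sup>2)) \<le> Phi n u v * 1"
    using n by (intro mult_left_mono Phi_nonneg) auto
  then have "P * (1 + s + 2 / 5 * s\<^sup>2) \<le> Phi n u v"
    unfolding P_def Phi_add2 by (simp add: mult_ac)
  moreover have "0 \<le> P * (2 / 5 * (s - m)\<^sup>2)"
    using P0 by simp
  moreover have "P * (m - s) = P * (10 - real (n + 4) * s) / real (n + 4)"
    by (simp add: m_def field_simps)
  then have "P * (m - s) \<le> D / real (n + 4)"
    using D by (simp add: divide_right_mono)
  then have "(1 + 4 / 5 * m) * (P * (m - s)) \<le> (1 + 4 / 5 * m) / real (n + 4) * D"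
    unfolding times_divide_eq_left times_divide_eq_right[symmetric]
    by (intro mult_left_mono) (auto simp: m_def)
  moreover have "(1 + m + 2 / 5 * m\<^sup>2) * P
      = P * (1 + s + 2 / 5 * s\<^sup>2) - P * (2 / 5 * (s - m)\<^sup>2) + (1 + 4 / 5 * m) * (P * (m - s))"
    by (simp add: field_simps power2_eq_square)
  ultimately show ?thesis
    unfolding P_def[symmetric] D_def[symmetric] by linarith
next
  case False
  then have "u = pi \<or> u = - pi \<or> v = pi \<or> v = - pi" using u v by linarith
  then have "sc u * sc v = 0" by (auto simp: sc_def)
  then have "Phi (n + 2) u v = 0" "dPhi (n + 2) u v = 0" "dPhi (n + 2) v u = 0"
    by (auto simp: Phi_def dPhi_def)
  then show ?thesis using Phi_nonneg[OF n, of u v] by simp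
qed

abbreviation lborel2 :: "(real \<times> real) measure" where
  "lborel2 \<equiv> lborel \<Otimes>\<^sub>M lborel"

text \<open>The square of the main lobe.\<close>

definition main_box :: "(real \<times> real) set" where
  "main_box = {- pi..pi} \<times> {- pi..pi}"

lemma main_box_borel [measurable]: "main_box \<in> sets (borel \<Otimes>\<^sub>M borel)"
  unfolding main_box_def by measurable

lemma integrable_main_box:
  fixes f :: "real \<times> real \<Rightarrow> real"
  assumes "continuous_on UNIV f"
  shows "integrable lborel2 (\<lambda>z. indicator main_box z * f z)"
  using borel_integrable_compact[of main_box f] assms
  unfolding lborel_prod main_box_def
  by (auto simp: compact_Times intro: continuous_on_subset)

lemma integral_main_box_dPhi:
  assumes "0 < n"
  shows "(\<integral>z. indicator main_box z * dPhi n (fst z) (snd z) \<partial>lborel2) = 0" (is ?A)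
    and "(\<integral>z. indicator main_box z * dPhi n (snd z) (fst z) \<partial>lborel2) = 0" (is ?B)
proof -
  have z: "(\<integral>u. indicator {- pi..pi} u * dPhi n u v \<partial>lborel) = 0" for v
  proof -
    have "set_integrable lborel {- pi..pi} (\<lambda>u. dPhi n u v)"
      by (intro borel_integrable_atLeastAtMost' continuous_intros)
    from set_borel_integral_eq_integral(2)[OF this] has_integral_dPhi[OF assms, of v]
    show ?thesis by (simp add: set_lebesgue_integral_def integral_unique)
  qed
  have ind: "indicator main_box (x, y) = (indicator {- pi..pi} x * indicator {- pi..pi} y :: real)" for x y
    by (simp add: main_box_def indicator_def)
  have i: "integrable lborel2 (\<lambda>z. indicator main_box z * dPhi n (fst z) (snd z))"
     "integrable lborel2 (\<lambda>z. indicator main_box z * dPhi n (snd z) (fst z))"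
    by (intro integrable_main_box continuous_intros)+
  have eq: "(\<lambda>x. indicator main_box (x, y) * dPhi n x y)
       = (\<lambda>x. indicator {- pi..pi} y * (indicator {- pi..pi} x * dPhi n x y))"
     "(\<lambda>x. indicator main_box (y, x) * dPhi n x y)
       = (\<lambda>x. indicator {- pi..pi} y * (indicator {- pi..pi} x * dPhi n x y))" for y
    by (auto simp: ind)
  \<comment> \<open>In each case the derivative is integrated first, over its own variable.\<close>
  show ?A
    using lborel_pair.integral_snd[of "\<lambda>x y. indicator main_box (x, y) * dPhi n x y"] i(1)
    by (simp add: case_prod_unfold eq z)
  have "(\<integral>z. indicator main_box z * dPhi n (snd z) (fst z) \<partial>lborel2)
      = (\<integral>x. (\<integral>y. indicator main_box (x, y) * dPhi n y x \<partial>lborel) \<partial>lborel)"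
    using lborel_pair.integral_fst[of "\<lambda>x y. indicator main_box (x, y) * dPhi n y x"] i(2)
    by (simp add: case_prod_unfold)
  also have "\<dots> = 0"
    by (simp only: eq) (simp add: z)
  finally show ?B .
qed

text \<open>With \<open>n = 2 * p - 2\<close> this compares \<open>D (p + 1)\<close> with \<open>D p\<close>; then \<open>m = 5 / (p + 1)\<close>.\<close>

lemma integral_Phi_le:
  fixes n :: nat
  assumes n: "even n" "2 \<le> n"
    and int: "integrable lborel2 (\<lambda>z. Phi n (fst z) (snd z))"
      "integrable lborel2 (\<lambda>z. Phi (n + 2) (fst z) (snd z))"
  defines "m \<equiv> 10 / real (n + 4)"
  shows "(1 + m + 2 / 5 * m\<^sup>2) * (\<integral>z. Phi (n + 2) (fst z) (snd z) \<partial>lborel2)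
     \<le> (\<integral>z. Phi n (fst z) (snd z) \<partial>lborel2)"
proof -
  define r c where "r = 1 + m + 2 / 5 * m\<^sup>2" and "c = (1 + 4 / 5 * m) / real (n + 4)"
  define f where "f z = indicator main_box z * dPhi (n + 2) (fst z) (snd z)" for z
  define g where "g z = indicator main_box z * dPhi (n + 2) (snd z) (fst z)" for z
  \<comment> \<open>The factor is at most \<open>34 / 9\<close>, less than the gain 9 outside the square.\<close>
  have "0 \<le> m" "m \<le> 5 / 3" using n by (auto simp: m_def field_simps)
  then have "m\<^sup>2 \<le> (5 / 3)\<^sup>2" by (intro power_mono)
  then have r: "0 \<le> r" "r \<le> 9" using \<open>0 \<le> m\<close> \<open>m \<le> 5 / 3\<close> by (auto simp: r_def power2_eq_square)
  have ifg: "integrable lborel2 f" "integrable lborel2 g"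
    unfolding f_def g_def by (intro integrable_main_box continuous_intros)+
  have "r * Phi (n + 2) (fst z) (snd z) - c * (f z + g z) \<le> Phi n (fst z) (snd z)" for z
  proof (cases "z \<in> main_box")
    case True
    then have "\<bar>fst z\<bar> \<le> pi" "\<bar>snd z\<bar> \<le> pi" by (auto simp: main_box_def)
    from Phi_main_lobe_le[OF this n(1)] show ?thesis
      unfolding r_def c_def m_def f_def g_def using True by simp
  next
    case False
    then have "pi < \<bar>fst z\<bar> \<or> pi < \<bar>snd z\<bar>" by (cases z) (auto simp: main_box_def)
    have sm: "\<bar>sc u\<bar> \<le> 1 / 3" if "pi < \<bar>u\<bar>" for u
    proof -
      have "3 * \<bar>sc u\<bar> \<le> \<bar>u\<bar> * \<bar>sc u\<bar>" using that pi_gt3 by (intro mult_right_mono) auto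
      also have "\<dots> \<le> 1" using abs_mult_sc_le[of u] by (simp add: abs_mult)
      finally show ?thesis by simp
    qed
    have "\<bar>sc (fst z) * sc (snd z)\<bar> \<le> 1 / 3"
    proof -
      have "\<bar>sc (fst z)\<bar> * \<bar>sc (snd z)\<bar> \<le> 1 / 3 * 1" if "pi < \<bar>fst z\<bar>"
        using that by (intro mult_mono sm abs_sc_le) auto
      moreover have "\<bar>sc (fst z)\<bar> * \<bar>sc (snd z)\<bar> \<le> 1 * (1 / 3)" if "pi < \<bar>snd z\<bar>"
        using that by (intro mult_mono sm abs_sc_le) auto
      ultimately show ?thesis
        using \<open>pi < \<bar>fst z\<bar> \<or> pi < \<bar>snd z\<bar>\<close> by (auto simp: abs_mult)
    qed
    then have "(sc (fst z) * sc (snd z))\<^sup>2 \<le> (1 / 3)\<^sup>2"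
      by (subst power2_abs[symmetric], intro power_mono) auto
    then have "r * (sc (fst z) * sc (snd z))\<^sup>2 \<le> 9 * (1 / 3)\<^sup>2"
      using r by (intro mult_mono) auto
    then have "Phi n (fst z) (snd z) * (r * (sc (fst z) * sc (snd z))\<^sup>2) \<le> Phi n (fst z) (snd z) * 1"
      using n by (intro mult_left_mono Phi_nonneg) (auto simp: power2_eq_square)
    then show ?thesis
      using False unfolding Phi_add2 by (simp add: f_def g_def mult_ac)
  qed
  then have "(\<integral>z. r * Phi (n + 2) (fst z) (snd z) - c * (f z + g z) \<partial>lborel2)
      \<le> (\<integral>z. Phi n (fst z) (snd z) \<partial>lborel2)"
    using int ifg by (intro integral_mono) auto
  also have "(\<integral>z. r * Phi (n + 2) (fst z) (snd z) - c * (f z + g z) \<partial>lborel2)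
     = r * (\<integral>z. Phi (n + 2) (fst z) (snd z) \<partial>lborel2)
       - c * (integral\<^sup>L lborel2 f + integral\<^sup>L lborel2 g)"
    using int ifg by simp
  also have "integral\<^sup>L lborel2 f + integral\<^sup>L lborel2 g = 0"
    unfolding f_def g_def by (simp only: integral_main_box_dPhi[of "n + 2"])
  finally show ?thesis by (simp add: r_def)
qed

section \<open>Integrals of powers of sinc\<close>

lemma sc_nonneg: "\<bar>u\<bar> \<le> pi \<Longrightarrow> 0 \<le> sc u"
  using sc_pos[of u] by (cases "\<bar>u\<bar> < pi"; cases "u = pi"; cases "u = - pi") (auto simp: sc_def)

text \<open>The contribution of the main lobe to the integral of a power of sinc; \<open>sc_tail\<close> below is the
  contribution of the side lobes.\<close>

definition sc_main :: "nat \<Rightarrow> real" where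
  "sc_main n = integral {- pi..pi} (\<lambda>u. sc u ^ n)"

definition sc_int :: "nat \<Rightarrow> real" where
  "sc_int n = (\<integral>u. sc u ^ n \<partial>lborel)"

lemma DERIV_mult_sc_power:
  assumes "u \<noteq> 0"
  shows "((\<lambda>u. u * sc u ^ n) has_real_derivative sc u ^ n + real n * sc u ^ (n - 1) * (u * dsc u)) (at u)"
  using assms by (auto intro!: derivative_eq_intros DERIV_sc)

text \<open>Compare \<open>S ^ (n + 1) - S ^ n\<close> with \<open>(u * S ^ n)'\<close>, whose integral over the main lobe is 0.\<close>

lemma sc_main_Suc_ge:
  assumes n: "0 < n"
  shows "(1 - 1 / (2 * real n)) * sc_main n \<le> sc_main (Suc n)"
proof -
  define f where "f u = sc u ^ n + real n * sc u ^ (n - 1) * (u * dsc u)" for u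
  have f: "(f has_integral (pi * sc pi ^ n - (- pi) * sc (- pi) ^ n)) {- pi..pi}"
    unfolding f_def
    by (rule fundamental_theorem_of_calculus_interior_strong[of "{0}"])
       (auto intro!: continuous_intros DERIV_mult_sc_power
          simp del: One_nat_def simp flip: has_real_derivative_iff_has_vector_derivative)
  have f0: "(f has_integral 0) {- pi..pi}"
    using f n by (simp add: sc_def power_0_left)
  have i: "((\<lambda>u. sc u ^ k) has_integral sc_main k) {- pi..pi}" for k
    unfolding sc_main_def
    by (intro integrable_integral integrable_continuous_interval continuous_intros)
  have "(1 - 1 / (2 * real n)) * sc_main n + 1 / (2 * real n) * 0 \<le> sc_main (Suc n)"
  proof (rule has_integral_le)
    show "((\<lambda>u. (1 - 1 / (2 * real n)) * sc u ^ n + 1 / (2 * real n) * f u) has_integral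
      (1 - 1 / (2 * real n)) * sc_main n + 1 / (2 * real n) * 0) {- pi..pi}"
      by (intro has_integral_add has_integral_mult_right i f0)
    show "((\<lambda>u. sc u ^ Suc n) has_integral sc_main (Suc n)) {- pi..pi}" by (rule i)
    fix u :: real assume "u \<in> {- pi..pi}"
    then have u: "\<bar>u\<bar> \<le> pi" by auto
    have "0 \<le> sc u ^ (n - 1) * (2 * (sc u)\<^sup>2 - 2 * sc u - u * dsc u)"
      using sc_quadratic_ineq[OF u] sc_nonneg[OF u] by simp
    moreover obtain k where k: "n = Suc k" using n by (cases n) auto
    moreover have "1 / (2 * real n) * f u = sc u ^ n / (2 * real n) + sc u ^ (n - 1) * (u * dsc u) / 2"
      using n by (simp add: f_def field_simps)
    ultimately show "(1 - 1 / (2 * real n)) * sc u ^ n + 1 / (2 * real n) * f u \<le> sc u ^ Suc n"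
      by (simp add: k algebra_simps power2_eq_square del: of_nat_Suc)
  qed
  then show ?thesis by simp
qed

lemma sc_main_nonneg: "0 \<le> sc_main n"
  unfolding sc_main_def
  by (intro integral_nonneg integrable_continuous_interval continuous_intros)
     (auto intro!: zero_le_power sc_nonneg)

lemma sc_ge: "0 < u \<Longrightarrow> 1 - u\<^sup>2 / 6 \<le> sc u"
proof -
  assume u: "0 < u"
  have "0 \<le> sin u - (u - u ^ 3 / 6)"
  proof (rule nonneg_if_deriv_nonneg[OF u, where f' = "\<lambda>u. cos u - (1 - u\<^sup>2 / 2)"])
    show "((\<lambda>u::real. sin u - (u - u ^ 3 / 6)) \<longlongrightarrow> 0) (at_right 0)" by real_asymp
    fix t :: real assume "0 < t"
    then show "0 \<le> cos t - (1 - t\<^sup>2 / 2)"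
    proof (rule nonneg_if_deriv_nonneg[where f' = "\<lambda>u. u - sin u"])
      show "((\<lambda>u::real. cos u - (1 - u\<^sup>2 / 2)) \<longlongrightarrow> 0) (at_right 0)" by real_asymp
    qed (auto intro!: derivative_eq_intros sin_x_le_x)
  qed (auto intro!: derivative_eq_intros)
  then show ?thesis using u by (simp add: sc_def field_simps power2_eq_square power3_eq_cube)
qed

lemma sc_main_4_ge: "14 / 9 \<le> sc_main 4"
proof -
  have le: "1 - 2 / 3 * u\<^sup>2 \<le> sc u ^ 4" if "\<bar>u\<bar> \<le> 1" for u :: real
  proof -
    have u2: "u\<^sup>2 \<le> 1" using that by (simp add: abs_square_le_1)
    have "1 - 2 / 3 * u\<^sup>2 \<le> (1 + (- u\<^sup>2 / 6)) ^ 4"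
      using Bernoulli_inequality[of "- u\<^sup>2 / 6" 4] u2 by simp
    also have "\<dots> = (1 - u\<^sup>2 / 6) ^ 4" by simp
    also have "\<dots> \<le> sc u ^ 4"
      using u2 sc_ge[of u] sc_ge[of "- u"]
      by (intro power_mono; cases u "0::real" rule: linorder_cases) (auto simp: sc_def)
    finally show ?thesis .
  qed
  have "((\<lambda>u::real. 1 - 2 / 3 * u\<^sup>2) has_integral
      (1 - 2 / 9 * 1 ^ 3) - ((- 1) - 2 / 9 * (- 1) ^ 3)) {- 1..1}"
    by (rule fundamental_theorem_of_calculus)
       (auto intro!: derivative_eq_intros simp flip: has_real_derivative_iff_has_vector_derivative)
  then have "((\<lambda>u::real. 1 - 2 / 3 * u\<^sup>2) has_integral 14 / 9) {- 1..1}"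
    by simp
  then have "14 / 9 \<le> integral {- 1..1} (\<lambda>u. sc u ^ 4)"
    by (rule has_integral_le[OF _ integrable_integral])
       (use le in \<open>auto intro!: integrable_continuous_interval continuous_intros simp: abs_le_iff\<close>)
  also have "\<dots> \<le> sc_main 4"
    unfolding sc_main_def using pi_gt3
    by (intro integral_subset_le integrable_continuous_interval continuous_intros) auto
  finally show ?thesis .
qed

lemma integrable_if_decay:
  fixes f :: "real \<Rightarrow> real"
  assumes cont: "continuous_on UNIV f" and decay: "\<And>u. u\<^sup>2 * \<bar>f u\<bar> \<le> C"
  shows "integrable lborel f"
proof -
  have "compact (f ` {- 1..1})"
    using cont by (intro compact_continuous_image) (auto intro: continuous_on_subset)
  then have "\<exists>K. \<forall>u\<in>{- 1..1}. \<bar>f u\<bar> \<le> K"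
    using compact_imp_bounded[of "f ` {- 1..1}"] by (auto simp: bounded_iff)
  then obtain K where K: "\<And>u. u \<in> {- 1..1} \<Longrightarrow> \<bar>f u\<bar> \<le> K" by blast
  have K0: "0 \<le> K" using K[of 0] by simp
  have C0: "0 \<le> C" using decay[of 0] by simp
  have b: "\<bar>f u\<bar> \<le> \<bar>(K + C) * inverse (1 + u\<^sup>2)\<bar> + \<bar>(K + C) * inverse (1 + u\<^sup>2)\<bar>" for u
  proof -
    have "\<bar>f u\<bar> * (1 + u\<^sup>2) \<le> 2 * (K + C)"
    proof (cases "\<bar>u\<bar> \<le> 1")
      case True
      then have "\<bar>f u\<bar> \<le> K" using K[of u] by (auto simp: abs_le_iff)
      then show ?thesis using decay[of u] C0 K0 by (simp add: algebra_simps)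
    next
      case False
      then have "1 \<le> u\<^sup>2" using abs_square_le_1[of u] by linarith
      then have "1 * \<bar>f u\<bar> \<le> u\<^sup>2 * \<bar>f u\<bar>" by (intro mult_right_mono) auto
      then show ?thesis using decay[of u] C0 K0 by (simp add: algebra_simps)
    qed
    then have "\<bar>f u\<bar> \<le> 2 * (K + C) / (1 + u\<^sup>2)"
      by (subst pos_le_divide_eq) (auto simp: add_pos_nonneg)
    also have "\<dots> = \<bar>(K + C) * inverse (1 + u\<^sup>2)\<bar> + \<bar>(K + C) * inverse (1 + u\<^sup>2)\<bar>"
      using C0 K0 by (simp add: field_simps)
    finally show ?thesis .
  qed
  have "integrable lborel (\<lambda>u::real. (K + C) * inverse (1 + u\<^sup>2))"
    using integrable_inverse_1_plus_square by (simp add: set_integrable_def)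
  then have "integrable lborel (\<lambda>u::real. \<bar>(K + C) * inverse (1 + u\<^sup>2)\<bar> + \<bar>(K + C) * inverse (1 + u\<^sup>2)\<bar>)"
    by (intro Bochner_Integration.integrable_add integrable_abs)
  then show ?thesis
    by (rule Bochner_Integration.integrable_bound)
       (use cont b in \<open>auto intro!: borel_measurable_continuous_onI\<close>)
qed

lemma square_sc_power_le:
  assumes "2 \<le> n"
  shows "u\<^sup>2 * \<bar>sc u ^ n\<bar> \<le> 1"
proof -
  obtain k where "n = 2 + k" using assms le_Suc_ex by blast
  then have "\<bar>sc u ^ n\<bar> = \<bar>sc u\<bar>\<^sup>2 * \<bar>sc u\<bar> ^ k"
    by (simp only: power_add abs_mult power_abs)
  then have "u\<^sup>2 * \<bar>sc u ^ n\<bar> = \<bar>u * sc u\<bar>\<^sup>2 * \<bar>sc u\<bar> ^ k"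
    by (simp only: abs_mult power_mult_distrib power2_abs mult.assoc)
  also have "\<dots> \<le> 1"
    using abs_mult_sc_le[of u] abs_sc_le[of u] by (intro mult_le_one power_le_one) auto
  finally show ?thesis .
qed

lemma integrable_sc_power: "2 \<le> n \<Longrightarrow> integrable lborel (\<lambda>u. sc u ^ n)"
  by (rule integrable_if_decay[of _ 1]) (auto intro!: continuous_intros square_sc_power_le)

definition sc_tail :: "nat \<Rightarrow> real" where
  "sc_tail n = (\<integral>u. indicator (- {- pi..pi}) u * sc u ^ n \<partial>lborel)"

lemma integrable_indicator_sc_power:
  "2 \<le> n \<Longrightarrow> A \<in> sets borel \<Longrightarrow> integrable lborel (\<lambda>u. indicator A u * sc u ^ n)"
  using integrable_mult_indicator[of A lborel "\<lambda>u. sc u ^ n"] integrable_sc_power by simp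

lemma sc_int_eq:
  assumes "2 \<le> n"
  shows "sc_int n = sc_main n + sc_tail n"
proof -
  have "set_integrable lborel {- pi..pi} (\<lambda>u. sc u ^ n)"
    by (intro borel_integrable_atLeastAtMost' continuous_intros)
  then have "sc_main n = (\<integral>u. indicator {- pi..pi} u * sc u ^ n \<partial>lborel)"
    using set_borel_integral_eq_integral(2)[of "{- pi..pi}" "\<lambda>u. sc u ^ n"]
    by (simp add: sc_main_def set_lebesgue_integral_def)
  then have "sc_main n + sc_tail n
     = (\<integral>u. indicator {- pi..pi} u * sc u ^ n + indicator (- {- pi..pi}) u * sc u ^ n \<partial>lborel)"
    unfolding sc_tail_def using assms by (simp add: integrable_indicator_sc_power)
  also have "\<dots> = sc_int n"
    unfolding sc_int_def by (intro Bochner_Integration.integral_cong) (auto simp: indicator_def)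
  finally show ?thesis ..
qed

lemma sc_tail_nonneg: "even n \<Longrightarrow> 0 \<le> sc_tail n"
  unfolding sc_tail_def by (intro Bochner_Integration.integral_nonneg) (auto simp: zero_le_even_power)

lemma sc_square_tail_le:
  assumes "pi < \<bar>u\<bar>"
  shows "(sc u)\<^sup>2 \<le> 1 / 9"
proof -
  have "9 * (sc u)\<^sup>2 \<le> u\<^sup>2 * (sc u)\<^sup>2"
    using assms pi_gt3 power_mono[of 3 "\<bar>u\<bar>" 2] by (intro mult_right_mono) auto
  also have "\<dots> \<le> 1" using square_sc_power_le[of 2 u] by simp
  finally show ?thesis by simp
qed

lemma sc_tail_add2_le:
  assumes "even n" "2 \<le> n"
  shows "sc_tail (n + 2) \<le> sc_tail n / 9"
proof -
  have "sc_tail (n + 2) \<le> (\<integral>u. (indicator (- {- pi..pi}) u * sc u ^ n) / 9 \<partial>lborel)"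
    unfolding sc_tail_def
  proof (intro integral_mono integrable_divide integrable_indicator_sc_power)
    fix u :: real
    show "indicator (- {- pi..pi}) u * sc u ^ (n + 2) \<le> (indicator (- {- pi..pi}) u * sc u ^ n) / 9"
    proof (cases "u \<in> {- pi..pi}")
      case False
      then have "pi < \<bar>u\<bar>" by auto
      then have "sc u ^ n * (sc u)\<^sup>2 \<le> sc u ^ n * (1 / 9)"
        using assms sc_square_tail_le by (intro mult_left_mono) (auto simp: zero_le_even_power)
      then show ?thesis using False unfolding power_add by simp
    qed simp
  qed (use assms in auto)
  then show ?thesis by (simp add: sc_tail_def)
qed

lemma sc_tail_4_le: "sc_tail 4 \<le> 2 / 81"
proof -
  define f :: "real \<Rightarrow> real" where "f u = indicator {3..} u * (1 / u ^ 4)" for u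
  have "(\<integral>\<^sup>+u. ennreal (1 / u ^ 4) * indicator {3..} u \<partial>lborel) = ennreal (0 - (- 1 / (3 * 3 ^ 3)))"
  proof (rule nn_integral_FTC_atLeast[where F = "\<lambda>u. - 1 / (3 * u ^ 3)"])
    show "((\<lambda>u::real. - 1 / (3 * u ^ 3)) \<longlongrightarrow> 0) at_top" by real_asymp
  qed (auto intro!: derivative_eq_intros simp: field_simps eval_nat_numeral)
  also have "(\<lambda>u. ennreal (1 / u ^ 4) * indicator {3..} u) = (\<lambda>u. ennreal (f u))"
    by (auto simp: f_def indicator_def)
  finally have nn: "(\<integral>\<^sup>+u. ennreal (f u) \<partial>lborel) = ennreal (1 / 81)" by simp
  have f: "has_bochner_integral lborel f (1 / 81)"
    by (rule has_bochner_integral_nn_integral) (use nn in \<open>auto simp: f_def[abs_def]\<close>)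
  have f': "has_bochner_integral lborel (\<lambda>u. f (- u)) (1 / 81)"
    using lborel_has_bochner_integral_real_affine_iff[of "- 1" f "1 / 81" 0] f by simp
  have "sc_tail 4 \<le> (\<integral>u. f u + f (- u) \<partial>lborel)"
    unfolding sc_tail_def
  proof (intro integral_mono integrable_indicator_sc_power Bochner_Integration.integrable_add)
    show "integrable lborel f" "integrable lborel (\<lambda>u. f (- u))"
      using f f' by (auto simp: has_bochner_integral_iff)
    \<comment> \<open>Majorise by the inverse fourth power on both sides of \<open>[- 3, 3]\<close>.\<close>
    fix u :: real
    have "sc u ^ 4 \<le> 1 / u ^ 4" if "u \<noteq> 0"
      using that abs_sin_le_one[of u] power_le_one[of "\<bar>sin u\<bar>" 4]
      by (simp add: sc_def power_divide divide_right_mono)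
    then show "indicator (- {- pi..pi}) u * sc u ^ 4 \<le> f u + f (- u)"
      using pi_gt3 by (auto simp: f_def indicator_def)
  qed auto
  also have "\<dots> = 2 / 81"
    using f f' by (simp add: has_bochner_integral_iff)
  finally show ?thesis .
qed

lemma sc_main_add2_ge:
  assumes "1 \<le> p"
  shows "(1 - 1 / (4 * real p)) * (1 - 1 / (4 * real p + 2)) * sc_main (2 * p) \<le> sc_main (2 * p + 2)"
proof -
  have "(1 - 1 / (4 * real p + 2)) * ((1 - 1 / (4 * real p)) * sc_main (2 * p))
      \<le> (1 - 1 / (4 * real p + 2)) * sc_main (2 * p + 1)"
    using sc_main_Suc_ge[of "2 * p"] assms by (intro mult_left_mono) auto
  also have "\<dots> \<le> sc_main (2 * p + 2)"
    using sc_main_Suc_ge[of "2 * p + 1"] by (simp add: algebra_simps)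
  finally show ?thesis by (simp add: mult_ac)
qed

lemma sc_tail_le:
  assumes "2 \<le> p"
  shows "sc_tail (2 * p) \<le> sc_main (2 * p) / (30 * real p)"
  using assms
proof (induction p rule: dec_induct)
  case base
  show ?case using sc_tail_4_le sc_main_4_ge by simp
next
  case (step p)
  have "3 / 4 * sc_main (2 * p) \<le> (1 - 1 / (4 * real p)) * (1 - 1 / (4 * real p + 2)) * sc_main (2 * p)"
  proof (rule mult_right_mono)
    have "(1 - 1 / 8) * (1 - 1 / 10) \<le> (1 - 1 / (4 * real p)) * (1 - 1 / (4 * real p + 2))"
      using step by (intro mult_mono diff_mono divide_left_mono) auto
    then show "3 / 4 \<le> (1 - 1 / (4 * real p)) * (1 - 1 / (4 * real p + 2))" by simp
  qed (rule sc_main_nonneg)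
  also have "\<dots> \<le> sc_main (2 * p + 2)" using sc_main_add2_ge step by simp
  finally have main: "3 / 4 * sc_main (2 * p) \<le> sc_main (2 * p + 2)" .
  have "sc_tail (2 * p + 2) \<le> sc_tail (2 * p) / 9"
    using step by (intro sc_tail_add2_le) auto
  also have "\<dots> \<le> sc_main (2 * p) / (30 * real p) / 9"
    using step by (intro divide_right_mono) auto
  also have "\<dots> \<le> (4 / 3 * sc_main (2 * p + 2)) / (30 * real p) / 9"
    using main by (intro divide_right_mono) auto
  \<comment> \<open>\<open>405 / 2 * p\<close> is far above \<open>30 * (p + 1)\<close>, so the bound reproduces itself.\<close>
  also have "\<dots> = sc_main (2 * p + 2) / (405 / 2 * real p)"
    by (simp add: field_simps)
  also have "\<dots> \<le> sc_main (2 * p + 2) / (30 * real (Suc p))"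
    using step sc_main_nonneg by (intro divide_left_mono) auto
  finally show ?case by simp
qed

lemma sc_int_add2_ge:
  assumes p: "2 \<le> p"
  shows "(1 - 1 / (4 * real p)) * (1 - 1 / (4 * real p + 2)) * sc_int (2 * p)
     \<le> (1 + 1 / (30 * real p)) * sc_int (2 * p + 2)" (is "?k * _ \<le> _")
proof -
  have k: "0 \<le> ?k" using p by (intro mult_nonneg_nonneg) (auto simp: field_simps)
  have "sc_int (2 * p) \<le> (1 + 1 / (30 * real p)) * sc_main (2 * p)"
    using sc_int_eq[of "2 * p"] sc_tail_le[OF p] p by (simp add: field_simps)
  then have "?k * sc_int (2 * p) \<le> ?k * ((1 + 1 / (30 * real p)) * sc_main (2 * p))"
    using k by (intro mult_left_mono)
  also have "\<dots> = (1 + 1 / (30 * real p)) * (?k * sc_main (2 * p))" by simp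
  also have "\<dots> \<le> (1 + 1 / (30 * real p)) * sc_main (2 * p + 2)"
    using sc_main_add2_ge p by (intro mult_left_mono) auto
  also have "\<dots> \<le> (1 + 1 / (30 * real p)) * sc_int (2 * p + 2)"
    using sc_int_eq[of "2 * p + 2"] sc_tail_nonneg[of "2 * p + 2"] by (intro mult_left_mono) auto
  finally show ?thesis .
qed

lemma sc_int_pos:
  assumes "2 \<le> p"
  shows "0 < sc_int (2 * p)"
proof -
  have "0 < sc_main n" if "4 \<le> n" for n
    using that
  proof (induction n rule: dec_induct)
    case base
    show ?case using sc_main_4_ge by simp
  next
    case (step n)
    then have "0 < (1 - 1 / (2 * real n)) * sc_main n"
      by (intro mult_pos_pos) (auto simp: field_simps)
    also have "\<dots> \<le> sc_main (Suc n)" using step by (intro sc_main_Suc_ge) auto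
    finally show ?case .
  qed
  then show ?thesis
    using assms sc_int_eq[of "2 * p"] sc_tail_nonneg[of "2 * p"] by (simp add: add_pos_nonneg)
qed

text \<open>Up to constants, \<open>dsc_moment (2 * p - 2)\<close> and \<open>sc_moment (2 * p - 2)\<close> are the second moments of the
  squares of \<open>rect_pow p\<close> and of its Fourier transform.\<close>

definition dsc_moment :: "nat \<Rightarrow> real" where
  "dsc_moment n = (\<integral>u. (dsc u)\<^sup>2 * sc u ^ n \<partial>lborel)"

definition sc_moment :: "nat \<Rightarrow> real" where
  "sc_moment n = (\<integral>u. u\<^sup>2 * sc u ^ (n + 2) \<partial>lborel)"

lemma integrable_dsc_moment:
  "2 \<le> n \<Longrightarrow> integrable lborel (\<lambda>u. (dsc u)\<^sup>2 * sc u ^ n)"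
proof (rule integrable_if_decay[of _ 4])
  fix u :: real
  have "u\<^sup>2 * \<bar>(dsc u)\<^sup>2 * sc u ^ n\<bar> = \<bar>u * dsc u\<bar>\<^sup>2 * \<bar>sc u\<bar> ^ n"
    by (simp add: abs_mult power_abs power_mult_distrib)
  also have "\<dots> \<le> 2\<^sup>2 * 1"
    using abs_mult_dsc_le[of u] abs_sc_le[of u] by (intro mult_mono power_mono power_le_one) auto
  finally show "u\<^sup>2 * \<bar>(dsc u)\<^sup>2 * sc u ^ n\<bar> \<le> 4" by simp
qed (intro continuous_intros)

lemma integrable_sc_moment:
  assumes "2 \<le> n"
  shows "integrable lborel (\<lambda>u. u\<^sup>2 * sc u ^ (n + 2))"
proof (rule integrable_if_decay[of _ 1])
  fix u :: real
  have "u\<^sup>2 * \<bar>u\<^sup>2 * sc u ^ (n + 2)\<bar> = (u\<^sup>2 * \<bar>sc u ^ n\<bar>) * (u\<^sup>2 * \<bar>sc u ^ 2\<bar>)"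
    unfolding power_add abs_mult by simp
  also have "\<dots> \<le> 1"
    using assms by (intro mult_le_one square_sc_power_le) auto
  finally show "u\<^sup>2 * \<bar>u\<^sup>2 * sc u ^ (n + 2)\<bar> \<le> 1" .
qed (intro continuous_intros)

lemma integrable_dsc_sc_moment:
  assumes "1 \<le> n"
  shows "integrable lborel (\<lambda>u. u * dsc u * sc u ^ (n + 1))"
proof (rule integrable_if_decay[of _ 2])
  fix u :: real
  have "u\<^sup>2 * \<bar>u * dsc u * sc u ^ (n + 1)\<bar> = \<bar>u * dsc u\<bar> * (u\<^sup>2 * \<bar>sc u ^ (n + 1)\<bar>)"
    by (simp add: abs_mult mult_ac)
  also have "\<dots> \<le> 2 * 1"
    using assms by (intro mult_mono square_sc_power_le abs_mult_dsc_le) auto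
  finally show "u\<^sup>2 * \<bar>u * dsc u * sc u ^ (n + 1)\<bar> \<le> 2" by simp
qed (intro continuous_intros)

lemma DERIV_mult_self_0:
  fixes f :: "real \<Rightarrow> real"
  assumes "isCont f 0"
  shows "((\<lambda>u. u * f u) has_real_derivative f 0) (at 0)"
  unfolding CARAT_DERIV using assms by (intro exI[of _ f]) (auto simp: mult.commute)

text \<open>Integration by parts: \<open>(u * S ^ (n + 2))'\<close> has integral 0.\<close>

lemma integral_dsc_sc_moment:
  assumes "1 \<le> n"
  shows "(\<integral>u. u * dsc u * sc u ^ (n + 1) \<partial>lborel) = - sc_int (n + 2) / real (n + 2)"
proof -
  define F where "F u = u * sc u ^ (n + 2)" for u
  define f where "f u = sc u ^ (n + 2) + real (n + 2) * (u * dsc u * sc u ^ (n + 1))" for u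
  have der: "(F has_real_derivative f u) (at u)" for u
  proof (cases "u = 0")
    case True
    then show ?thesis
      using DERIV_mult_self_0[of "\<lambda>u. sc u ^ (n + 2)"] isCont_sc
      by (auto simp: F_def[abs_def] f_def intro!: continuous_intros)
  next
    case False
    then show ?thesis
      using DERIV_mult_sc_power[of u "n + 2"] by (simp add: F_def[abs_def] f_def mult_ac)
  qed
  have int: "integrable lborel f"
    unfolding f_def using assms
    by (intro Bochner_Integration.integrable_add integrable_sc_power integrable_mult_right
        integrable_dsc_sc_moment) auto
  have bound: "\<bar>F u\<bar> \<le> inverse \<bar>u\<bar>" for u
  proof (cases "u = 0")
    case False
    have "\<bar>u\<bar> * \<bar>F u\<bar> = u\<^sup>2 * \<bar>sc u ^ (n + 2)\<bar>"
      by (simp add: F_def abs_mult power2_eq_square)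
    also have "\<dots> \<le> 1" by (intro square_sc_power_le) auto
    finally show ?thesis using False by (simp add: field_simps)
  qed (simp add: F_def)
  have "(LBINT u=-\<infinity>..\<infinity>. f u) = 0 - 0"
  proof (rule interval_integral_FTC_integrable)
    show "(F has_vector_derivative f x) (at x)" for x
      using der by (simp add: has_real_derivative_iff_has_vector_derivative)
    show "isCont f x" for x
      unfolding f_def by (intro continuous_intros isCont_sc isCont_dsc)
    show "set_integrable lborel (einterval (- \<infinity>) \<infinity>) f"
      using int by (simp add: set_integrable_def)
    have top: "((\<lambda>u. inverse \<bar>u\<bar>) \<longlongrightarrow> (0::real)) at_top" "((\<lambda>u. inverse \<bar>u\<bar>) \<longlongrightarrow> (0::real)) at_bot"
      by real_asymp+
    show "((F \<circ> real_of_ereal) \<longlongrightarrow> 0) (at_right (- \<infinity>))"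
      using Lim_null_comparison[of F, OF always_eventually top(2)] bound
      by (simp add: ereal_tendsto_simps)
    show "((F \<circ> real_of_ereal) \<longlongrightarrow> 0) (at_left \<infinity>)"
      using Lim_null_comparison[of F, OF always_eventually top(1)] bound
      by (simp add: ereal_tendsto_simps)
  qed simp
  then have "integral\<^sup>L lborel f = 0"
    by (simp add: interval_lebesgue_integral_def set_lebesgue_integral_def)
  moreover have "integral\<^sup>L lborel f
      = sc_int (n + 2) + real (n + 2) * (\<integral>u. u * dsc u * sc u ^ (n + 1) \<partial>lborel)"
    unfolding f_def sc_int_def using assms integrable_sc_power[of "n + 2"] integrable_dsc_sc_moment[of n]
    by (subst Bochner_Integration.integral_add) auto
  ultimately show ?thesis by (simp add: field_simps)
qed

lemma product_lborel2:
  fixes f g :: "real \<Rightarrow> real"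
  assumes f: "integrable lborel f" and g: "integrable lborel g"
  shows "integrable lborel2 (\<lambda>z. f (fst z) * g (snd z))"
    and "(\<integral>z. f (fst z) * g (snd z) \<partial>lborel2) = integral\<^sup>L lborel f * integral\<^sup>L lborel g"
proof -
  show i: "integrable lborel2 (\<lambda>z. f (fst z) * g (snd z))"
  proof (rule lborel_pair.Fubini_integrable)
    show "integrable lborel (\<lambda>x. \<integral>y. norm (f (fst (x, y)) * g (snd (x, y))) \<partial>lborel)"
      using f g by (simp add: abs_mult)
    show "AE x in lborel. integrable lborel (\<lambda>y. f (fst (x, y)) * g (snd (x, y)))"
      using g by simp
  qed (use f g in measurable)
  show "(\<integral>z. f (fst z) * g (snd z) \<partial>lborel2) = integral\<^sup>L lborel f * integral\<^sup>L lborel g"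
    using lborel_pair.integral_fst'[OF i] by simp
qed

text \<open>For even \<open>n\<close> this is Lagrange's identity for the functions \<open>S' * S ^ (n / 2)\<close> and \<open>u * S * S ^ (n / 2)\<close>.\<close>

lemma integral_Phi:
  assumes n: "2 \<le> n"
  shows "integrable lborel2 (\<lambda>z. Phi n (fst z) (snd z))"
    and "(\<integral>z. Phi n (fst z) (snd z) \<partial>lborel2)
       = 2 * (dsc_moment n * sc_moment n - (sc_int (n + 2) / real (n + 2))\<^sup>2)"
proof -
  define a b c where "a u = (dsc u)\<^sup>2 * sc u ^ n" and "b u = u\<^sup>2 * sc u ^ (n + 2)"
    and "c u = u * dsc u * sc u ^ (n + 1)" for u
  have abc: "integrable lborel a" "integrable lborel b" "integrable lborel c"
    unfolding a_def b_def c_def using n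
    by (auto intro!: integrable_dsc_moment integrable_sc_moment[simplified] integrable_dsc_sc_moment[simplified])
  have eq: "Phi n u v = a u * b v - 2 * (c u * c v) + b u * a v" for u v
    unfolding Phi_def wedge_def a_def b_def c_def power_add power_mult_distrib
    by (simp add: algebra_simps power2_eq_square)
  note p = product_lborel2[OF abc(1,2)] product_lborel2[OF abc(3,3)] product_lborel2[OF abc(2,1)]
  show "integrable lborel2 (\<lambda>z. Phi n (fst z) (snd z))"
    unfolding eq using p by auto
  have "(\<integral>z. Phi n (fst z) (snd z) \<partial>lborel2)
      = integral\<^sup>L lborel a * integral\<^sup>L lborel b - 2 * (integral\<^sup>L lborel c * integral\<^sup>L lborel c)
        + integral\<^sup>L lborel b * integral\<^sup>L lborel a"
    unfolding eq using p by simp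
  also have "integral\<^sup>L lborel c = - sc_int (n + 2) / real (n + 2)"
    using integral_dsc_sc_moment[of n] n unfolding c_def by simp
  also have "integral\<^sup>L lborel a = dsc_moment n" by (simp add: a_def[abs_def] dsc_moment_def)
  also have "integral\<^sup>L lborel b = sc_moment n" by (simp add: b_def[abs_def] sc_moment_def)
  finally show "(\<integral>z. Phi n (fst z) (snd z) \<partial>lborel2)
       = 2 * (dsc_moment n * sc_moment n - (sc_int (n + 2) / real (n + 2))\<^sup>2)"
    by (simp add: power2_eq_square algebra_simps)
qed

text \<open>The left-hand factor \<open>1 + 1 / (30 * p)\<close> pays for the side lobes. After clearing denominators the
  inequality has only positive coefficients as a polynomial in \<open>p - 2\<close>.\<close>

lemma ratio_bounds_combine:
  fixes p :: real
  assumes "2 \<le> p"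
  shows "(p + 1)\<^sup>2 * (1 + 1 / (30 * p))\<^sup>2 \<le>
    p\<^sup>2 * (1 + 5 / (p + 1) + 2 / 5 * (5 / (p + 1))\<^sup>2) * ((1 - 1 / (4 * p)) * (1 - 1 / (4 * p + 2)))\<^sup>2"
proof -
  define x where "x = p - 2"
  have x: "0 \<le> x" "p = x + 2" using assms by (auto simp: x_def)
  have "64 * (p + 1) ^ 4 * (30 * p + 1)\<^sup>2 * (2 * p + 1)\<^sup>2
      \<le> 900 * p\<^sup>2 * (p\<^sup>2 + 7 * p + 16) * (16 * p\<^sup>2 - 1)\<^sup>2"
    unfolding x(2) using x(1)
    by (simp add: algebra_simps eval_nat_numeral add_nonneg_nonneg)
  then have "((p + 1) * (30 * p + 1) / (30 * p))\<^sup>2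
      \<le> p\<^sup>2 * ((p\<^sup>2 + 7 * p + 16) / (p + 1)\<^sup>2) * ((16 * p\<^sup>2 - 1) / (8 * p * (2 * p + 1)))\<^sup>2"
    using assms by (simp add: divide_simps power_mult_distrib) (simp add: algebra_simps eval_nat_numeral)
  also have "(p + 1) * (30 * p + 1) / (30 * p) = (p + 1) * (1 + 1 / (30 * p))"
    using assms by (simp add: field_simps)
  also have "(p\<^sup>2 + 7 * p + 16) / (p + 1)\<^sup>2 = 1 + 5 / (p + 1) + 2 / 5 * (5 / (p + 1))\<^sup>2"
    using assms by (simp add: divide_simps) (simp add: algebra_simps power2_eq_square)
  also have "(16 * p\<^sup>2 - 1) / (8 * p * (2 * p + 1)) = (1 - 1 / (4 * p)) * (1 - 1 / (4 * p + 2))"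
    using assms by (simp add: divide_simps) (simp add: algebra_simps power2_eq_square)
  finally show ?thesis by (simp add: power_mult_distrib)
qed

text \<open>The uncertainty product of \<open>rect_pow p\<close>, in terms of integrals of sinc.\<close>

definition sc_uncertainty :: "nat \<Rightarrow> real" where
  "sc_uncertainty p = (real p)\<^sup>2 * dsc_moment (2 * p - 2) * sc_moment (2 * p - 2) / (sc_int (2 * p))\<^sup>2"

text \<open>The gap to the Heisenberg bound \<open>1 / 4\<close>.\<close>

lemma sc_uncertainty_eq:
  assumes p: "2 \<le> p"
  shows "sc_uncertainty p = 1 / 4 +
    (real p)\<^sup>2 * (\<integral>z. Phi (2 * p - 2) (fst z) (snd z) \<partial>lborel2) / (2 * (sc_int (2 * p))\<^sup>2)"
proof -
  have "2 * p - 2 + 2 = 2 * p" using p by simp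
  then show ?thesis
    unfolding sc_uncertainty_def using integral_Phi(2)[of "2 * p - 2"] p sc_int_pos[OF p]
    by (simp add: field_simps power2_eq_square)
qed

theorem sc_uncertainty_Suc_le:
  assumes p: "2 \<le> p"
  shows "sc_uncertainty (p + 1) \<le> sc_uncertainty p"
proof -
  define D D' J J' where "D = (\<integral>z. Phi (2 * p - 2) (fst z) (snd z) \<partial>lborel2)"
    and "D' = (\<integral>z. Phi (2 * (p + 1) - 2) (fst z) (snd z) \<partial>lborel2)"
    and "J = sc_int (2 * p)" and "J' = sc_int (2 * (p + 1))"
  define q r k t where "q = real p" and "r = 1 + 5 / (q + 1) + 2 / 5 * (5 / (q + 1))\<^sup>2"
    and "k = (1 - 1 / (4 * q)) * (1 - 1 / (4 * q + 2))" and "t = 1 + 1 / (30 * q)"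
  have q: "2 \<le> q" using p by (simp add: q_def)
  have J: "0 < J" "0 < J'" using sc_int_pos[of p] sc_int_pos[of "p + 1"] p by (auto simp: J_def J'_def)
  have e: "2 * (p + 1) - 2 = 2 * p - 2 + 2" using p by auto
  have m: "5 / (q + 1) = 10 / real (2 * p - 2 + 4)" using p by (simp add: q_def field_simps)
  have D: "r * D' \<le> D"
    unfolding D_def D'_def e m r_def using p by (intro integral_Phi_le integral_Phi(1)) auto
  have D'0: "0 \<le> D'"
    unfolding D'_def by (intro Bochner_Integration.integral_nonneg Phi_nonneg) auto
  have Jk: "k * J \<le> t * J'"
    using sc_int_add2_ge[OF p] by (simp add: k_def t_def J_def J'_def q_def)
  have "0 < k"
    unfolding k_def using q by (intro mult_pos_pos) (auto simp: divide_less_eq)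
  moreover have "0 < t" "0 < r"
    unfolding t_def r_def using q by (auto intro!: add_pos_nonneg)
  ultimately have k0: "0 < k" "0 < t" "0 < r" .
  have "((q + 1) * t * k * J)\<^sup>2 * D' = ((q + 1)\<^sup>2 * t\<^sup>2) * ((k * J)\<^sup>2 * D')"
    by (simp add: power_mult_distrib)
  also have "\<dots> \<le> (q\<^sup>2 * r * k\<^sup>2) * ((t * J')\<^sup>2 * D')"
  proof (rule mult_mono)
    show "(q + 1)\<^sup>2 * t\<^sup>2 \<le> q\<^sup>2 * r * k\<^sup>2"
      using ratio_bounds_combine[OF q] by (simp only: r_def k_def t_def)
    show "(k * J)\<^sup>2 * D' \<le> (t * J')\<^sup>2 * D'"
      using Jk k0 J D'0 by (intro mult_right_mono power_mono) auto
  qed (use k0 D'0 in auto)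
  also have "\<dots> = (q\<^sup>2 * k\<^sup>2 * (t * J')\<^sup>2) * (r * D')" by simp
  also have "\<dots> \<le> (q\<^sup>2 * k\<^sup>2 * (t * J')\<^sup>2) * D"
    using D by (intro mult_left_mono) auto
  finally have "(t * k)\<^sup>2 * ((q + 1)\<^sup>2 * D' * J\<^sup>2) \<le> (t * k)\<^sup>2 * (q\<^sup>2 * D * J'\<^sup>2)"
    by (simp add: power_mult_distrib mult_ac)
  then have "(q + 1)\<^sup>2 * D' * J\<^sup>2 \<le> q\<^sup>2 * D * J'\<^sup>2"
    using k0 by simp
  then have "(q + 1)\<^sup>2 * D' / (2 * J'\<^sup>2) \<le> q\<^sup>2 * D / (2 * J\<^sup>2)"
    using J by (simp add: field_simps)
  then show ?thesis
    using sc_uncertainty_eq[of p] sc_uncertainty_eq[of "p + 1"] p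
    unfolding D_def[symmetric] D'_def[symmetric] J_def[symmetric] J'_def[symmetric] q_def
    by (simp add: add.commute)
qed

section \<open>Plancherel's identity for continuous functions of compact support\<close>

text \<open>Integrability is not required: the Bochner integral of a function that is not integrable is 0.\<close>

lemma integral_odd_lborel:
  fixes f :: "real \<Rightarrow> real"
  assumes "\<And>x. f (- x) = - f x"
  shows "(\<integral>x. f x \<partial>lborel) = 0"
  using lborel_integral_real_affine[of "- 1" f 0] assms by simp

lemma integrable_compact_support:
  fixes f :: "real \<Rightarrow> real"
  assumes cont: "continuous_on UNIV f" and supp: "\<And>x. x \<notin> {- R..R} \<Longrightarrow> f x = 0"
  shows "integrable lborel f"
proof -
  have "set_integrable lborel {- R..R} f"
    using cont by (intro borel_integrable_atLeastAtMost') (auto intro: continuous_on_subset)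
  then have "integrable lborel (\<lambda>x. indicator {- R..R} x *\<^sub>R f x)"
    by (simp add: set_integrable_def)
  also have "(\<lambda>x. indicator {- R..R} x *\<^sub>R f x) = f"
    using supp by (auto simp: indicator_def fun_eq_iff)
  finally show ?thesis .
qed

lemma integral_std_normal_iexp:
  fixes s t :: real
  assumes s: "0 < s"
  shows "(\<integral>w. complex_of_real (std_normal_density (s * w)) * exp (\<i> * of_real w * of_real t) \<partial>lborel)
    = complex_of_real (sqrt (2 * pi) / s * std_normal_density (t / s))"
proof -
  have "(\<integral>w. complex_of_real (std_normal_density (s * w)) * exp (\<i> * of_real w * of_real t) \<partial>lborel)
    = (\<integral>z. complex_of_real (std_normal_density z) * exp (\<i> * of_real (t / s) * of_real z) \<partial>lborel) / of_real s"
    using lborel_integral_real_affine[of s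
        "\<lambda>z. complex_of_real (std_normal_density z) * exp (\<i> * of_real (t / s) * of_real z)" 0] s
    by (simp add: scaleR_conv_of_real field_simps)
  also have "(\<integral>z. complex_of_real (std_normal_density z) * exp (\<i> * of_real (t / s) * of_real z) \<partial>lborel)
    = char std_normal_distribution (t / s)"
    unfolding char_def
    by (subst integral_density) (auto simp: scaleR_conv_of_real mult.assoc)
  also have "char std_normal_distribution (t / s) = complex_of_real (exp (- (t / s)\<^sup>2 / 2))"
    by (simp add: char_std_normal_distribution)
  also have "exp (- (t / s)\<^sup>2 / 2) = sqrt (2 * pi) * std_normal_density (t / s)"
    by (simp add: std_normal_density_def)
  finally show ?thesis by simp
qed

lemma integrable_std_normal_scaled:
  assumes "0 < (s::real)"
  shows "integrable lborel (\<lambda>w. std_normal_density (s * w))"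
  using lborel_integrable_real_affine[of std_normal_density s 0] assms integrable_normal_density[of 1 0]
  by simp

lemma integrable_lborel2_mult_bound:
  fixes h :: "real \<times> real \<Rightarrow> complex" and a b :: "real \<Rightarrow> real"
  assumes "integrable lborel a" "integrable lborel b"
    and "h \<in> borel_measurable lborel2"
    and "\<And>x y. cmod (h (x, y)) \<le> \<bar>a x * b y\<bar>"
  shows "integrable lborel2 h"
  by (rule Bochner_Integration.integrable_bound[OF product_lborel2(1)[OF assms(1,2)]])
     (use assms(3,4) in auto)

lemma fourier_of_real_cnj:
  "cnj (fourier (\<lambda>x. complex_of_real (f x)) w) = (\<integral>x. exp (\<i> * of_real w * of_real x) * complex_of_real (f x) \<partial>lborel)"
  unfolding fourier_def Bochner_Integration.integral_cnj[symmetric] by (simp add: exp_cnj)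

lemma norm_fourier_le:
  "cmod (fourier (\<lambda>x. complex_of_real (f x)) w) \<le> (\<integral>x. \<bar>f x\<bar> \<partial>lborel)"
  unfolding fourier_def by (rule integral_norm_bound[THEN order_trans]) (simp add: norm_mult)

lemma borel_measurable_fourier [measurable]:
  assumes [measurable]: "f \<in> borel_measurable borel"
  shows "fourier f \<in> borel_measurable borel"
  unfolding fourier_def[abs_def] by measurable

text \<open>With a Gaussian weight, Fubini's theorem applies, and the integral over the frequency is known.\<close>

lemma plancherel_regularized:
  fixes f :: "real \<Rightarrow> real"
  assumes f: "integrable lborel f" and s: "0 < s"
  shows "(\<integral>w. std_normal_density (s * w) * (cmod (fourier (\<lambda>x. complex_of_real (f x)) w))\<^sup>2 \<partial>lborel)
    = sqrt (2 * pi) * (\<integral>x. f x * (\<integral>z. f (x + s * z) * std_normal_density z \<partial>lborel) \<partial>lborel)"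
proof -
  define F where "F = fourier (\<lambda>x. complex_of_real (f x))"
  define n where "n w = std_normal_density (s * w)" for w
  define K where "K = (\<integral>x. \<bar>f x\<bar> \<partial>lborel)"
  define h where "h x = (\<integral>z. f (x + s * z) * std_normal_density z \<partial>lborel)" for x
  have [measurable]: "f \<in> borel_measurable borel" using f by auto
  have [measurable]: "F \<in> borel_measurable borel" unfolding F_def by measurable
  have [measurable]: "(\<lambda>w. cnj (F w)) \<in> borel_measurable borel"
    by (rule measurable_compose[of F _ borel]) (auto intro!: borel_measurable_continuous_onI continuous_intros)
  have [measurable]: "n \<in> borel_measurable borel" unfolding n_def by measurable
  have n: "integrable lborel n" unfolding n_def using s by (rule integrable_std_normal_scaled)
  have n0: "0 \<le> n w" for w by (simp add: n_def)
  have K: "cmod (F w) \<le> K" for w unfolding F_def K_def by (rule norm_fourier_le)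
  have K0: "0 \<le> K" unfolding K_def by simp
  \<comment> \<open>The inverse transform of the weighted conjugate is a Gaussian average of \<open>f\<close> around \<open>x\<close>.\<close>
  have inner: "(\<integral>w. of_real (n w) * exp (- \<i> * of_real w * of_real x) * cnj (F w) \<partial>lborel)
      = complex_of_real (sqrt (2 * pi) * h x)" for x
  proof -
    have "(\<integral>w. of_real (n w) * exp (- \<i> * of_real w * of_real x) * cnj (F w) \<partial>lborel)
      = (\<integral>w. (\<integral>y. of_real (n w) * exp (\<i> * of_real w * of_real (y - x)) * complex_of_real (f y) \<partial>lborel) \<partial>lborel)"
      unfolding F_def fourier_of_real_cnj integral_mult_right_zero[symmetric]
      by (intro Bochner_Integration.integral_cong refl)
         (simp add: algebra_simps exp_diff exp_minus divide_inverse)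
    also have "\<dots> = (\<integral>y. (\<integral>w. of_real (n w) * exp (\<i> * of_real w * of_real (y - x)) * complex_of_real (f y) \<partial>lborel) \<partial>lborel)"
      by (rule lborel_pair.Fubini_integral[symmetric], rule integrable_lborel2_mult_bound[OF n f])
         (auto simp: norm_mult n0 abs_mult)
    also have "\<dots> = (\<integral>y. complex_of_real (f y * (sqrt (2 * pi) / s * std_normal_density ((y - x) / s))) \<partial>lborel)"
      by (simp only: integral_mult_left_zero integral_std_normal_iexp[OF s, folded n_def]) (simp add: mult.commute)
    also have "\<dots> = complex_of_real (\<integral>y. f y * (sqrt (2 * pi) / s * std_normal_density ((y - x) / s)) \<partial>lborel)"
      by (rule integral_complex_of_real)
    also have "(\<integral>y. f y * (sqrt (2 * pi) / s * std_normal_density ((y - x) / s)) \<partial>lborel)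
       = s * (\<integral>z. f (x + s * z) * (sqrt (2 * pi) / s * std_normal_density z) \<partial>lborel)"
      using lborel_integral_real_affine[of s "\<lambda>y. f y * (sqrt (2 * pi) / s * std_normal_density ((y - x) / s))" x] s
      by simp
    also have "\<dots> = s * (sqrt (2 * pi) / s * (\<integral>z. f (x + s * z) * std_normal_density z \<partial>lborel))"
      by (subst integral_mult_right_zero[symmetric]) (simp add: mult_ac)
    also have "\<dots> = sqrt (2 * pi) * h x"
      using s by (simp add: h_def)
    finally show ?thesis .
  qed
  have "complex_of_real (\<integral>w. n w * (cmod (F w))\<^sup>2 \<partial>lborel)
      = (\<integral>w. of_real (n w) * (F w * cnj (F w)) \<partial>lborel)"
    by (subst integral_complex_of_real[symmetric]) (simp only: of_real_mult complex_norm_square)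
  also have "\<dots> = (\<integral>w. (\<integral>x. (of_real (n w) * exp (- \<i> * of_real w * of_real x) * cnj (F w)) * complex_of_real (f x) \<partial>lborel) \<partial>lborel)"
  proof (intro Bochner_Integration.integral_cong refl)
    fix w
    have "of_real (n w) * (F w * cnj (F w))
       = (of_real (n w) * cnj (F w)) * (\<integral>x. exp (- \<i> * of_real w * of_real x) * complex_of_real (f x) \<partial>lborel)"
      by (simp add: F_def fourier_def)
    also have "\<dots> = (\<integral>x. (of_real (n w) * cnj (F w)) * (exp (- \<i> * of_real w * of_real x) * complex_of_real (f x)) \<partial>lborel)"
      by (rule integral_mult_right_zero[symmetric])
    finally show "of_real (n w) * (F w * cnj (F w)) = (\<integral>x. (of_real (n w) * exp (- \<i> * of_real w * of_real x) * cnj (F w)) * complex_of_real (f x) \<partial>lborel)"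
      by (simp add: mult_ac)
  qed
  also have "\<dots> = (\<integral>x. (\<integral>w. (of_real (n w) * exp (- \<i> * of_real w * of_real x) * cnj (F w)) * complex_of_real (f x) \<partial>lborel) \<partial>lborel)"
  proof (rule lborel_pair.Fubini_integral[symmetric], rule integrable_lborel2_mult_bound[of "\<lambda>w. K * n w" f])
    show "integrable lborel (\<lambda>w. K * n w)" using n by simp
    show "cmod (case (w, x) of (w, x) \<Rightarrow> (of_real (n w) * exp (- \<i> * of_real w * of_real x) * cnj (F w)) * complex_of_real (f x))
        \<le> \<bar>K * n w * f x\<bar>" for w x
      using mult_right_mono[OF mult_left_mono[OF K[of w] n0[of w]], of "\<bar>f x\<bar>"] n0[of w] K0
      by (simp add: norm_mult abs_mult mult_ac)
  qed (rule f, measurable)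
  also have "\<dots> = (\<integral>x. complex_of_real (sqrt (2 * pi) * h x) * complex_of_real (f x) \<partial>lborel)"
    by (simp only: integral_mult_left_zero inner)
  also have "\<dots> = complex_of_real (\<integral>x. sqrt (2 * pi) * (f x * h x) \<partial>lborel)"
    by (subst integral_complex_of_real[symmetric]) (simp add: mult_ac)
  finally show ?thesis
    unfolding of_real_eq_iff by (simp add: n_def F_def h_def)
qed

text \<open>The weight is removed by letting its width tend to infinity; then the Gaussian averages of \<open>f\<close> on
  the other side concentrate.\<close>

theorem plancherel:
  fixes f :: "real \<Rightarrow> real"
  assumes cont: "continuous_on UNIV f" and supp: "\<And>x. x \<notin> {- R..R} \<Longrightarrow> f x = 0"
    and int: "integrable lborel (\<lambda>w. (cmod (fourier (\<lambda>x. complex_of_real (f x)) w))\<^sup>2)"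
  shows "(\<integral>w. (cmod (fourier (\<lambda>x. complex_of_real (f x)) w))\<^sup>2 \<partial>lborel) = 2 * pi * (\<integral>x. (f x)\<^sup>2 \<partial>lborel)"
proof -
  define F where "F w = (cmod (fourier (\<lambda>x. complex_of_real (f x)) w))\<^sup>2" for w
  define s where "s k = 1 / real (Suc k)" for k
  define h where "h k x = (\<integral>z. f (x + s k * z) * std_normal_density z \<partial>lborel)" for k x
  have f: "integrable lborel f" by (rule integrable_compact_support[OF cont supp])
  then have [measurable]: "f \<in> borel_measurable borel" by auto
  have F: "integrable lborel F" using int by (simp add: F_def[abs_def])
  then have [measurable]: "F \<in> borel_measurable borel" by auto
  have s0: "0 < s k" for k by (simp add: s_def)
  have s: "s \<longlonglongrightarrow> 0" unfolding s_def[abs_def] using lim_1_over_n LIMSEQ_Suc[of "\<lambda>n. 1 / real n"] by simp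
  obtain K where K: "\<And>x. \<bar>f x\<bar> \<le> K"
  proof -
    have "compact (f ` {- R..R})"
      using cont by (intro compact_continuous_image) (auto intro: continuous_on_subset)
    then have "\<exists>K. \<forall>x\<in>{- R..R}. \<bar>f x\<bar> \<le> K"
      using compact_imp_bounded[of "f ` {- R..R}"] by (auto simp: bounded_iff)
    then obtain K where "\<And>x. x \<in> {- R..R} \<Longrightarrow> \<bar>f x\<bar> \<le> K" by blast
    then have "\<bar>f x\<bar> \<le> \<bar>K\<bar>" for x using supp[of x] by (cases "x \<in> {- R..R}") force+
    then show thesis by (rule that)
  qed
  have K0: "0 \<le> K" using K[of 0] by simp
  have nd: "integrable lborel std_normal_density" "(\<integral>z. std_normal_density z \<partial>lborel) = 1"
    by (auto simp: integral_normal_density)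
  have bnd: "std_normal_density z \<le> 1 / sqrt (2 * pi)" for z
    by (simp add: std_normal_density_def divide_right_mono)
  have "(\<lambda>k. \<integral>w. std_normal_density (s k * w) * F w \<partial>lborel) \<longlonglongrightarrow> (\<integral>w. std_normal_density 0 * F w \<partial>lborel)"
  proof (rule integral_dominated_convergence[where w = "\<lambda>w. 1 / sqrt (2 * pi) * F w"])
    have c: "isCont std_normal_density x" for x
      unfolding std_normal_density_def[abs_def] by (intro continuous_intros) auto
    show "AE w in lborel. (\<lambda>k. std_normal_density (s k * w) * F w) \<longlonglongrightarrow> std_normal_density 0 * F w"
    proof (intro AE_I2 tendsto_mult tendsto_const)
      fix w :: real
      have "(\<lambda>k. s k * w) \<longlonglongrightarrow> 0 * w" by (intro tendsto_mult s tendsto_const)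
      then show "(\<lambda>k. std_normal_density (s k * w)) \<longlonglongrightarrow> std_normal_density 0"
        using isCont_tendsto_compose[OF c[of 0]] by simp
    qed
    show "AE w in lborel. norm (std_normal_density (s k * w) * F w) \<le> 1 / sqrt (2 * pi) * F w" for k
    proof (intro AE_I2)
      fix w
      have "std_normal_density (s k * w) * F w \<le> 1 / sqrt (2 * pi) * F w"
        by (intro mult_right_mono bnd) (simp add: F_def)
      then show "norm (std_normal_density (s k * w) * F w) \<le> 1 / sqrt (2 * pi) * F w"
        by (simp add: F_def abs_mult)
    qed
  qed (use F in auto)
  moreover have "(\<lambda>k. sqrt (2 * pi) * (\<integral>x. f x * h k x \<partial>lborel)) \<longlonglongrightarrow> sqrt (2 * pi) * (\<integral>x. f x * f x \<partial>lborel)"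
  proof (intro tendsto_mult tendsto_const integral_dominated_convergence[where w = "\<lambda>x. K * \<bar>f x\<bar>"])
    have hb: "\<bar>h k x\<bar> \<le> K" for k x
    proof -
      have "\<bar>h k x\<bar> \<le> (\<integral>z. \<bar>f (x + s k * z) * std_normal_density z\<bar> \<partial>lborel)"
        unfolding h_def by (rule integral_abs_bound)
      also have "\<dots> \<le> (\<integral>z. K * std_normal_density z \<partial>lborel)"
      proof (rule integral_mono_AE')
        show "integrable lborel (\<lambda>z. K * std_normal_density z)" using nd by simp
      qed (use K K0 in \<open>auto simp: abs_mult intro!: mult_right_mono\<close>)
      also have "\<dots> = K" using nd by simp
      finally show ?thesis .
    qed
    show "AE x in lborel. norm (f x * h k x) \<le> K * \<bar>f x\<bar>" for k
    proof (intro AE_I2)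
      fix x
      have "\<bar>h k x\<bar> * \<bar>f x\<bar> \<le> K * \<bar>f x\<bar>" by (intro mult_right_mono hb) auto
      then show "norm (f x * h k x) \<le> K * \<bar>f x\<bar>" by (simp add: abs_mult mult.commute)
    qed
    show "AE x in lborel. (\<lambda>k. f x * h k x) \<longlonglongrightarrow> f x * f x"
    proof (intro AE_I2 tendsto_mult tendsto_const)
      fix x
      have "(\<lambda>k. h k x) \<longlonglongrightarrow> (\<integral>z. f x * std_normal_density z \<partial>lborel)"
        unfolding h_def
      proof (rule integral_dominated_convergence[where w = "\<lambda>z. K * std_normal_density z"])
        show "AE z in lborel. (\<lambda>k. f (x + s k * z) * std_normal_density z) \<longlonglongrightarrow> f x * std_normal_density z"
        proof (intro AE_I2 tendsto_mult tendsto_const)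
          fix z :: real
          have "(\<lambda>k. x + s k * z) \<longlonglongrightarrow> x + 0 * z" by (intro tendsto_intros s)
          moreover have "isCont f x" using cont by (simp add: continuous_on_eq_continuous_at)
          ultimately show "(\<lambda>k. f (x + s k * z)) \<longlonglongrightarrow> f x"
            using isCont_tendsto_compose[of x f] by simp
        qed
        show "AE z in lborel. norm (f (x + s k * z) * std_normal_density z) \<le> K * std_normal_density z" for k
          using K by (auto simp: abs_mult intro!: mult_right_mono)
      qed (use nd in auto)
      then show "(\<lambda>k. h k x) \<longlonglongrightarrow> f x" using nd by simp
    qed
    show "integrable lborel (\<lambda>x. K * \<bar>f x\<bar>)" using f by simp
    show "(\<lambda>x. f x * h k x) \<in> borel_measurable lborel" for k
      unfolding h_def by measurable
  qed auto
  moreover have "(\<integral>w. std_normal_density (s k * w) * F w \<partial>lborel) = sqrt (2 * pi) * (\<integral>x. f x * h k x \<partial>lborel)" for k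
    using plancherel_regularized[OF f s0[of k]] by (simp add: F_def h_def)
  ultimately have "(\<integral>w. std_normal_density 0 * F w \<partial>lborel) = sqrt (2 * pi) * (\<integral>x. f x * f x \<partial>lborel)"
    by (simp add: LIMSEQ_unique)
  then have "(\<integral>w. F w \<partial>lborel) / sqrt (2 * pi) = sqrt (2 * pi) * (\<integral>x. f x * f x \<partial>lborel)"
    by (simp add: std_normal_density_def)
  then have "(\<integral>w. F w \<partial>lborel) = (sqrt (2 * pi))\<^sup>2 * (\<integral>x. f x * f x \<partial>lborel)"
    by (simp add: field_simps power2_eq_square)
  then show ?thesis by (simp add: F_def power2_eq_square)
qed

section \<open>Iterated rect functions and their Fourier transforms\<close>

lemma rect_eq: "rect x = (if \<bar>x\<bar> \<le> 1 / 2 then 1 else 0)"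
  by (auto simp: rect_def indicator_def abs_le_iff)

lemma borel_measurable_rect [measurable]: "rect \<in> borel_measurable borel"
  unfolding rect_def by measurable

lemma rect_diff_eq: "rect (x - s) = indicat_real {x - 1 / 2..x + 1 / 2} s"
proof -
  have "\<bar>x - s\<bar> \<le> 1 / 2 \<longleftrightarrow> s \<in> {x - 1 / 2..x + 1 / 2}"
    unfolding atLeastAtMost_iff by linarith
  then show ?thesis unfolding rect_eq indicator_def by simp
qed

lemma rect_pow_step:
  "rect_pow (Suc (Suc p)) x = (\<integral>s. rect (x - s) * rect_pow (Suc p) s \<partial>lborel)"
  by (simp add: set_lebesgue_integral_def rect_diff_eq)

lemma integral_abs_rect: "(\<integral>s. \<bar>rect (x - s)\<bar> \<partial>lborel) = 1" "integrable lborel (\<lambda>s. rect (x - s))"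
  by (simp_all add: rect_diff_eq)

lemma rect_pow_basic:
  "rect_pow (Suc p) \<in> borel_measurable borel \<and>
   (\<forall>x. 0 \<le> rect_pow (Suc p) x \<and> rect_pow (Suc p) x \<le> 1) \<and>
   (\<forall>x. real (Suc p) / 2 < \<bar>x\<bar> \<longrightarrow> rect_pow (Suc p) x = 0) \<and>
   (\<forall>x. rect_pow (Suc p) (- x) = rect_pow (Suc p) x)"
proof (induction p)
  case 0
  show ?case by (auto simp: rect_eq)
next
  case (Suc p)
  define g where "g = rect_pow (Suc p)"
  have [measurable]: "g \<in> borel_measurable borel" and
    g: "0 \<le> g x" "g x \<le> 1" "real (Suc p) / 2 < \<bar>x\<bar> \<Longrightarrow> g x = 0" "g (- x) = g x" for x
    using Suc by (auto simp: g_def)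
  have e: "rect_pow (Suc (Suc p)) = (\<lambda>x. \<integral>s. rect (x - s) * g s \<partial>lborel)"
    unfolding g_def rect_pow_step[abs_def] ..
  have "0 \<le> (\<integral>s. rect (x - s) * g s \<partial>lborel)" for x
    using g by (intro Bochner_Integration.integral_nonneg) (auto simp: rect_eq)
  moreover have "(\<integral>s. rect (x - s) * g s \<partial>lborel) \<le> 1" for x
  proof -
    have "(\<integral>s. rect (x - s) * g s \<partial>lborel) \<le> (\<integral>s. \<bar>rect (x - s)\<bar> \<partial>lborel)"
      by (rule integral_mono_AE') (use integral_abs_rect g in \<open>auto simp: rect_eq\<close>)
    then show ?thesis by (simp add: integral_abs_rect)
  qed
  moreover have "(\<integral>s. rect (x - s) * g s \<partial>lborel) = 0" if "real (Suc (Suc p)) / 2 < \<bar>x\<bar>" for x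
  proof -
    have "rect (x - s) * g s = 0" for s
    proof (cases "\<bar>x - s\<bar> \<le> 1 / 2")
      case True
      then have "\<bar>x\<bar> \<le> \<bar>s\<bar> + 1 / 2" by linarith
      then have "real (Suc p) / 2 < \<bar>s\<bar>" using that by (simp add: field_simps)
      then show ?thesis using g by simp
    qed (simp add: rect_eq)
    then show ?thesis by (simp only: integral_zero)
  qed
  moreover have "(\<integral>s. rect (- x - s) * g s \<partial>lborel) = (\<integral>s. rect (x - s) * g s \<partial>lborel)" for x
  proof -
    have "(\<integral>s. rect (- x - s) * g s \<partial>lborel) = (\<integral>s. rect (- x - (- s)) * g (- s) \<partial>lborel)"
      using lborel_integral_real_affine[of "- 1" "\<lambda>s. rect (- x - s) * g s" 0] by simp
    also have "\<dots> = (\<integral>s. rect (x - s) * g s \<partial>lborel)"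
    proof (intro Bochner_Integration.integral_cong refl)
      show "rect (- x - (- s)) * g (- s) = rect (x - s) * g s" for s
        using abs_minus_commute[of s x] by (simp add: g rect_eq)
    qed
    finally show ?thesis .
  qed
  moreover have "(\<lambda>x. \<integral>s. rect (x - s) * g s \<partial>lborel) \<in> borel_measurable borel"
    by measurable
  ultimately show ?case unfolding e by blast
qed

lemma borel_measurable_rect_pow [measurable]: "rect_pow p \<in> borel_measurable borel"
  using rect_pow_basic[of "p - 1"] by (cases p) auto

lemma rect_pow_nonneg: "0 \<le> rect_pow p x" and rect_pow_le: "rect_pow p x \<le> 1"
  and rect_pow_minus: "rect_pow p (- x) = rect_pow p x"
  using rect_pow_basic[of "p - 1"] by (cases p; auto)+

lemma rect_pow_support: "x \<notin> {- real p..real p} \<Longrightarrow> rect_pow p x = 0"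
  using rect_pow_basic[of "p - 1"] by (cases p) (auto simp: field_simps)

lemma integrable_rect_pow: "integrable lborel (rect_pow p)"
proof (rule Bochner_Integration.integrable_bound)
  show "integrable lborel (indicat_real {- real p..real p})" by simp
  show "AE x in lborel. norm (rect_pow p x) \<le> norm (indicat_real {- real p..real p} x)"
    using rect_pow_nonneg rect_pow_le rect_pow_support[of _ p] by (auto simp: indicator_def)
qed simp

text \<open>The function \<^const>\<open>rect\<close> itself is discontinuous, which is why the index starts at 2 here.\<close>

lemma continuous_on_rect_pow:
  assumes "2 \<le> p"
  shows "continuous_on A (rect_pow p)"
proof -
  obtain q where p: "p = Suc (Suc q)" using assms by (metis add_2_eq_Suc le_Suc_ex)
  define g where "g = rect_pow (Suc q)"
  have [measurable]: "g \<in> borel_measurable borel" by (simp add: g_def)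
  have g: "integrable lborel g" unfolding g_def by (rule integrable_rect_pow)
  have "(\<lambda>n. rect_pow p (X n)) \<longlonglongrightarrow> rect_pow p x" if X: "X \<longlonglongrightarrow> x" for X x
    unfolding p rect_pow_step g_def[symmetric]
  proof (rule integral_dominated_convergence[where w = "\<lambda>s. \<bar>g s\<bar>"])
    have "AE s in lborel. s \<noteq> x - 1 / 2 \<and> s \<noteq> x + 1 / 2"
      using AE_lborel_singleton[of "x - 1 / 2"] AE_lborel_singleton[of "x + 1 / 2"] by eventually_elim auto
    then show "AE s in lborel. (\<lambda>n. rect (X n - s) * g s) \<longlonglongrightarrow> rect (x - s) * g s"
    proof eventually_elim
      case (elim s)
      have "(\<lambda>n. \<bar>X n - s\<bar>) \<longlonglongrightarrow> \<bar>x - s\<bar>" by (intro tendsto_intros X)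
      note lim = order_tendstoD[OF this]
      consider "\<bar>x - s\<bar> < 1 / 2" | "\<bar>x - s\<bar> > 1 / 2" using elim by linarith
      then have "eventually (\<lambda>n. rect (X n - s) = rect (x - s)) sequentially"
      proof cases
        case 1
        show ?thesis using lim(2)[OF 1] by eventually_elim (use 1 in \<open>simp add: rect_eq\<close>)
      next
        case 2
        show ?thesis using lim(1)[OF 2] by eventually_elim (use 2 in \<open>simp add: rect_eq\<close>)
      qed
      then have "(\<lambda>n. rect (X n - s)) \<longlonglongrightarrow> rect (x - s)"
        by (rule tendsto_eventually)
      then show ?case by (intro tendsto_intros)
    qed
    show "AE s in lborel. norm (rect (X n - s) * g s) \<le> \<bar>g s\<bar>" for n
      by (auto simp: rect_eq)
  qed (use g in auto)
  then have "continuous_on UNIV (rect_pow p)"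
    by (simp add: continuous_on_sequentially comp_def)
  then show ?thesis by (rule continuous_on_subset) simp
qed

lemma fourier_rect: "fourier (\<lambda>x. complex_of_real (rect x)) w = of_real (sc (w / 2))"
proof (cases "w = 0")
  case True
  then show ?thesis
    by (simp add: fourier_def sc_def integral_complex_of_real) (simp add: rect_def)
next
  case False
  have "((\<lambda>x. exp (- \<i> * of_real w * of_real x)) has_integral
      (exp (- \<i> * of_real w * of_real (1 / 2)) / (- \<i> * of_real w)
       - exp (- \<i> * of_real w * of_real (- 1 / 2)) / (- \<i> * of_real w))) {- 1 / 2..1 / 2}"
    using False
    by (intro fundamental_theorem_of_calculus)
       (auto intro!: derivative_eq_intros has_vector_derivative_real_field)
  also have "exp (- \<i> * of_real w * of_real (1 / 2)) = cis (- (w / 2))"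
    by (simp add: cis_conv_exp)
  also have "exp (- \<i> * of_real w * of_real (- 1 / 2)) = cis (w / 2)"
    by (simp add: cis_conv_exp)
  also have "cis (- (w / 2)) / (- \<i> * of_real w)
       - cis (w / 2) / (- \<i> * of_real w) = of_real (sc (w / 2))"
    using False
    by (simp add: sc_def divide_simps) (simp add: complex_eq_iff)
  finally have i: "integral {- 1 / 2..1 / 2} (\<lambda>x. exp (- \<i> * of_real w * of_real x)) = of_real (sc (w / 2))"
    by (rule integral_unique)
  have "set_integrable lborel {- 1 / 2..1 / 2} (\<lambda>x. exp (- \<i> * of_real w * of_real x))"
    by (intro borel_integrable_atLeastAtMost' continuous_intros)
  from set_borel_integral_eq_integral(2)[OF this] i
  have "(\<integral>x. indicat_real {- 1 / 2..1 / 2} x *\<^sub>R exp (- \<i> * of_real w * of_real x) \<partial>lborel) = of_real (sc (w / 2))"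
    by (simp add: set_lebesgue_integral_def)
  then show ?thesis
    by (simp add: fourier_def rect_def scaleR_conv_of_real mult.commute)
qed

lemma fourier_rect_pow_step:
  "fourier (\<lambda>x. complex_of_real (rect_pow (Suc (Suc p)) x)) w
   = of_real (sc (w / 2)) * fourier (\<lambda>x. complex_of_real (rect_pow (Suc p) x)) w"
proof -
  define g where "g = rect_pow (Suc p)"
  have [measurable]: "g \<in> borel_measurable borel" by (simp add: g_def)
  have g: "integrable lborel g" unfolding g_def by (rule integrable_rect_pow)
  have "fourier (\<lambda>x. complex_of_real (rect_pow (Suc (Suc p)) x)) w
    = (\<integral>x. (\<integral>s. exp (- \<i> * of_real w * of_real x) * complex_of_real (rect (x - s) * g s) \<partial>lborel) \<partial>lborel)"
    unfolding fourier_def rect_pow_step g_def[symmetric]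
    by (simp only: integral_mult_right_zero integral_complex_of_real)
  also have "\<dots> = (\<integral>s. (\<integral>x. exp (- \<i> * of_real w * of_real x) * complex_of_real (rect (x - s) * g s) \<partial>lborel) \<partial>lborel)"
  proof (rule lborel_pair.Fubini_integral)
    show "integrable lborel2 (\<lambda>(s, x). exp (- \<i> * of_real w * of_real x) * complex_of_real (rect (x - s) * g s))"
    proof (rule lborel_pair.Fubini_integrable)
      have r: "(\<integral>x. \<bar>rect (x - s)\<bar> \<partial>lborel) = 1" "integrable lborel (\<lambda>x. rect (x - s))" for s
      proof -
        have "rect (x - s) = rect (s - x)" for x by (simp add: rect_eq abs_minus_commute)
        then show "(\<integral>x. \<bar>rect (x - s)\<bar> \<partial>lborel) = 1" "integrable lborel (\<lambda>x. rect (x - s))"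
          using integral_abs_rect[of s] by simp_all
      qed
      show "integrable lborel (\<lambda>s. \<integral>x. norm (case (s, x) of (s, x) \<Rightarrow> exp (- \<i> * of_real w * of_real x) * complex_of_real (rect (x - s) * g s)) \<partial>lborel)"
        using g by (simp add: norm_mult r abs_mult)
      show "AE s in lborel. integrable lborel (\<lambda>x. case (s, x) of (s, x) \<Rightarrow> exp (- \<i> * of_real w * of_real x) * complex_of_real (rect (x - s) * g s))"
      proof (intro AE_I2)
        fix s
        have "integrable lborel (\<lambda>x. rect (x - s) * g s)" using r by simp
        then show "integrable lborel (\<lambda>x. case (s, x) of (s, x) \<Rightarrow> exp (- \<i> * of_real w * of_real x) * complex_of_real (rect (x - s) * g s))"
          by (rule Bochner_Integration.integrable_bound) (auto simp: norm_mult abs_mult)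
      qed
    qed measurable
  qed
  also have "\<dots> = (\<integral>s. of_real (sc (w / 2)) * (exp (- \<i> * of_real w * of_real s) * complex_of_real (g s)) \<partial>lborel)"
  proof (intro Bochner_Integration.integral_cong refl)
    fix s
    have "(\<integral>x. exp (- \<i> * of_real w * of_real x) * complex_of_real (rect (x - s) * g s) \<partial>lborel)
      = (\<integral>x. exp (- \<i> * of_real w * of_real (s + x)) * complex_of_real (rect x * g s) \<partial>lborel)"
      using lborel_integral_real_affine[of 1 "\<lambda>x. exp (- \<i> * of_real w * of_real x) * complex_of_real (rect (x - s) * g s)" s]
      by simp
    also have "\<dots> = (\<integral>x. (exp (- \<i> * of_real w * of_real s) * complex_of_real (g s)) * (exp (- \<i> * of_real w * of_real x) * complex_of_real (rect x)) \<partial>lborel)"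
      by (intro Bochner_Integration.integral_cong) (simp_all add: algebra_simps exp_add exp_diff divide_inverse exp_minus)
    also have "\<dots> = of_real (sc (w / 2)) * (exp (- \<i> * of_real w * of_real s) * complex_of_real (g s))"
      unfolding integral_mult_right_zero fourier_rect[unfolded fourier_def] by (simp add: mult_ac)
    finally show "(\<integral>x. exp (- \<i> * of_real w * of_real x) * complex_of_real (rect (x - s) * g s) \<partial>lborel)
      = of_real (sc (w / 2)) * (exp (- \<i> * of_real w * of_real s) * complex_of_real (g s))" .
  qed
  finally show ?thesis by (simp add: fourier_def g_def)
qed

lemma fourier_rect_pow:
  "fourier (\<lambda>x. complex_of_real (rect_pow (Suc p) x)) w = of_real (sc (w / 2) ^ Suc p)"
proof (induction p)
  case 0
  show ?case using fourier_rect by simp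
next
  case (Suc p)
  then show ?case unfolding fourier_rect_pow_step by simp
qed

section \<open>The uncertainty product\<close>

lemma integral_real_scale:
  fixes f :: "real \<Rightarrow> real"
  shows "(\<integral>w. f (w / 2) \<partial>lborel) = 2 * (\<integral>u. f u \<partial>lborel)"
  using lborel_integral_real_affine[of 2 "\<lambda>w. f (w / 2)" 0] by simp

lemma integrable_real_scale:
  fixes f :: "real \<Rightarrow> real"
  shows "integrable lborel f \<Longrightarrow> integrable lborel (\<lambda>w. f (w / 2))"
  using lborel_integrable_real_affine[of f "1 / 2" 0] by simp

lemma integral_mult_compact_support:
  fixes f g :: "real \<Rightarrow> real"
  assumes f: "continuous_on UNIV f" and g: "continuous_on UNIV g"
    and supp: "\<And>x. x \<notin> {- R..R} \<Longrightarrow> f x = 0"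
  shows "(\<integral>x. f x * g x \<partial>lborel) = integral {- R..R} (\<lambda>x. f x * g x)"
proof -
  have "set_integrable lborel {- R..R} (\<lambda>x. f x * g x)"
    using f g by (intro borel_integrable_atLeastAtMost' continuous_intros) (auto intro: continuous_on_subset)
  then have "integral {- R..R} (\<lambda>x. f x * g x) = (\<integral>x. indicator {- R..R} x *\<^sub>R (f x * g x) \<partial>lborel)"
    using set_borel_integral_eq_integral(2)[of "{- R..R}" "\<lambda>x. f x * g x"]
    by (simp add: set_lebesgue_integral_def)
  also have "\<dots> = (\<integral>x. f x * g x \<partial>lborel)"
    using supp by (intro Bochner_Integration.integral_cong) (auto simp: indicator_def)
  finally show ?thesis ..
qed

lemma cos_sin_fourier:
  fixes f :: "real \<Rightarrow> real"
  assumes f: "integrable lborel f"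
  shows "fourier (\<lambda>x. complex_of_real (f x)) w
    = of_real (\<integral>x. f x * cos (w * x) \<partial>lborel) - \<i> * of_real (\<integral>x. f x * sin (w * x) \<partial>lborel)"
proof -
  have i: "integrable lborel (\<lambda>x. f x * cos (w * x))" "integrable lborel (\<lambda>x. f x * sin (w * x))"
    by (rule Bochner_Integration.integrable_bound[OF f];
        use f in \<open>auto simp: abs_mult intro!: mult_left_le\<close>)+
  have "fourier (\<lambda>x. complex_of_real (f x)) w
     = (\<integral>x. of_real (f x * cos (w * x)) - \<i> * of_real (f x * sin (w * x)) \<partial>lborel)"
    unfolding fourier_def
  proof (intro Bochner_Integration.integral_cong refl)
    fix x
    have "exp (- \<i> * of_real w * of_real x) = cis (- (w * x))"
      by (simp add: cis_conv_exp mult.assoc)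
    then show "exp (- \<i> * of_real w * of_real x) * complex_of_real (f x)
       = of_real (f x * cos (w * x)) - \<i> * of_real (f x * sin (w * x))"
      by (simp add: complex_eq_iff)
  qed
  also have "\<dots> = of_real (\<integral>x. f x * cos (w * x) \<partial>lborel) - \<i> * of_real (\<integral>x. f x * sin (w * x) \<partial>lborel)"
    using i by (subst Bochner_Integration.integral_diff) (auto simp: integral_complex_of_real simp del: of_real_mult)
  finally show ?thesis .
qed

abbreviation crect_pow :: "nat \<Rightarrow> real \<Rightarrow> complex" where
  "crect_pow p \<equiv> \<lambda>x. complex_of_real (rect_pow p x)"

lemma fourier_crect_pow:
  assumes p: "2 \<le> p"
  shows "fourier (crect_pow p) w = of_real (sc (w / 2) ^ p)"
  using fourier_rect_pow[of "p - 1" w] p by simp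

lemma L2_norm_crect_pow:
  assumes p: "2 \<le> p"
  shows "(L2_norm (crect_pow p))\<^sup>2 = sc_int (2 * p) / pi"
proof -
  have eq: "(\<lambda>w. (cmod (fourier (crect_pow p) w))\<^sup>2) = (\<lambda>w. sc (w / 2) ^ (2 * p))"
    by (simp only: fourier_crect_pow[OF p] norm_of_real power2_abs power_even_eq)
  have "(\<integral>w. (cmod (fourier (crect_pow p) w))\<^sup>2 \<partial>lborel) = 2 * pi * (\<integral>x. (rect_pow p x)\<^sup>2 \<partial>lborel)"
  proof (rule plancherel)
    show "integrable lborel (\<lambda>w. (cmod (fourier (crect_pow p) w))\<^sup>2)"
      unfolding eq using p by (intro integrable_real_scale integrable_sc_power) auto
  qed (auto intro: continuous_on_rect_pow[OF p] rect_pow_support)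
  then have "2 * sc_int (2 * p) = 2 * pi * (\<integral>x. (rect_pow p x)\<^sup>2 \<partial>lborel)"
    unfolding eq sc_int_def by (simp add: integral_real_scale[of "\<lambda>u. sc u ^ (2 * p)"])
  moreover have "(L2_norm (crect_pow p))\<^sup>2 = (\<integral>x. (rect_pow p x)\<^sup>2 \<partial>lborel)"
    by (simp add: L2_norm_def)
  ultimately show ?thesis by (simp add: field_simps)
qed

lemma mean_x_crect_pow: "mean_x (crect_pow p) = 0"
  unfolding mean_x_def using integral_odd_lborel[of "\<lambda>x. x * (cmod ((crect_pow p) x))\<^sup>2"]
  by (simp add: rect_pow_minus)

lemma mean_freq_crect_pow:
  assumes p: "2 \<le> p"
  shows "mean_freq (crect_pow p) = 0"
  unfolding mean_freq_def using integral_odd_lborel[of "\<lambda>w. w * (cmod (fourier (crect_pow p) w))\<^sup>2"]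
  by (simp add: fourier_crect_pow[OF p])

text \<open>Differentiation of \<open>\<integral> cos (\<omega> * x) * rect_pow p x = S (\<omega> / 2) ^ p\<close> under the integral sign.\<close>

lemma fourier_mult_rect_pow:
  assumes p: "2 \<le> p" and w: "w \<noteq> 0"
  shows "fourier (\<lambda>x. complex_of_real (x * rect_pow p x)) w
    = \<i> * of_real (real p * sc (w / 2) ^ (p - 1) * dsc (w / 2) / 2)"
proof -
  define R where "R = real p"
  have supp: "rect_pow p x = 0" if "x \<notin> {- R..R}" for x
    using that unfolding R_def by (rule rect_pow_support)
  have cosh: "(\<integral>x. rect_pow p x * cos (w * x) \<partial>lborel) = sc (w / 2) ^ p" for w
    using cos_sin_fourier[OF integrable_rect_pow[of p], of w] unfolding fourier_crect_pow[OF p]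
    by (simp add: complex_eq_iff)
  have int_cos: "integral (cbox (- R) R) (\<lambda>x. rect_pow p x * cos (w * x)) = sc (w / 2) ^ p" for w
    using integral_mult_compact_support[of "rect_pow p" "\<lambda>x. cos (w * x)" R] supp cosh[of w] continuous_on_rect_pow[OF p]
    by (simp add: continuous_intros)
  have "((\<lambda>w. integral (cbox (- R) R) (\<lambda>x. rect_pow p x * cos (w * x))) has_real_derivative
      integral (cbox (- R) R) (\<lambda>x. rect_pow p x * (- sin (w * x) * x))) (at w within UNIV)"
  proof (rule leibniz_rule_field_derivative)
    show "(\<lambda>x. rect_pow p x * cos (w * x)) integrable_on cbox (- R) R" for w
      by (intro integrable_continuous continuous_intros continuous_on_rect_pow[OF p])
    show "continuous_on (UNIV \<times> cbox (- R) R) (\<lambda>(w, x). rect_pow p x * (- sin (w * x) * x))"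
      unfolding case_prod_unfold
      by (intro continuous_intros continuous_on_compose2[OF continuous_on_rect_pow[OF p]]) auto
  qed (auto intro!: derivative_eq_intros)
  then have "((\<lambda>w. sc (w / 2) ^ p) has_real_derivative
      integral (cbox (- R) R) (\<lambda>x. rect_pow p x * (- sin (w * x) * x))) (at w)"
    by (simp only: int_cos)
  moreover have "((\<lambda>w. sc (w / 2) ^ p) has_real_derivative
      real p * sc (w / 2) ^ (p - 1) * dsc (w / 2) / 2) (at w)"
    using w by (auto intro!: derivative_eq_intros DERIV_chain2[OF DERIV_sc])
  ultimately have "integral (cbox (- R) R) (\<lambda>x. rect_pow p x * (- sin (w * x) * x))
      = real p * sc (w / 2) ^ (p - 1) * dsc (w / 2) / 2"
    by (rule DERIV_unique)
  also have "integral (cbox (- R) R) (\<lambda>x. rect_pow p x * (- sin (w * x) * x))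
     = (\<integral>x. rect_pow p x * (- sin (w * x) * x) \<partial>lborel)"
    using integral_mult_compact_support[of "rect_pow p" "\<lambda>x. - sin (w * x) * x" R] supp continuous_on_rect_pow[OF p]
    by (simp add: continuous_intros)
  also have "\<dots> = - (\<integral>x. x * rect_pow p x * sin (w * x) \<partial>lborel)"
    by (subst integral_minus[symmetric]) (simp add: mult_ac)
  finally have S: "(\<integral>x. x * rect_pow p x * sin (w * x) \<partial>lborel) = - (real p * sc (w / 2) ^ (p - 1) * dsc (w / 2) / 2)"
    by simp
  have C: "(\<integral>x. x * rect_pow p x * cos (w * x) \<partial>lborel) = 0"
    by (rule integral_odd_lborel) (simp add: rect_pow_minus)
  have "integrable lborel (\<lambda>x. x * rect_pow p x)"
    by (rule integrable_compact_support[of _ R]) (auto intro!: continuous_intros continuous_on_rect_pow[OF p] supp)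
  from cos_sin_fourier[OF this, of w] show ?thesis
    by (simp add: S C)
qed

lemma second_moment_rect_pow:
  assumes p: "2 \<le> p"
  shows "(\<integral>x. x\<^sup>2 * (rect_pow p x)\<^sup>2 \<partial>lborel) = (real p)\<^sup>2 * dsc_moment (2 * p - 2) / (4 * pi)"
proof -
  define f where "f u = (real p)\<^sup>2 / 4 * ((dsc u)\<^sup>2 * sc u ^ (2 * p - 2))" for u
  have ae: "AE w in lborel. (cmod (fourier (\<lambda>x. complex_of_real (x * rect_pow p x)) w))\<^sup>2 = f (w / 2)"
    using AE_lborel_singleton[of 0]
  proof eventually_elim
    case (elim w)
    have "2 * p - 2 = 2 * (p - 1)" by simp
    then have "(sc (w / 2) ^ (p - 1))\<^sup>2 = sc (w / 2) ^ (2 * p - 2)"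
      by (simp only: power_even_eq)
    moreover have "(cmod (\<i> * complex_of_real r))\<^sup>2 = r\<^sup>2" for r
      by (simp add: norm_mult)
    ultimately show ?case
      unfolding fourier_mult_rect_pow[OF p elim] by (simp only: f_def power_mult_distrib power_divide) simp
  qed
  have f: "integrable lborel f"
    unfolding f_def using p by (intro integrable_mult_right integrable_dsc_moment) auto
  have m: "(\<lambda>x. complex_of_real (x * rect_pow p x)) \<in> borel_measurable borel" by measurable
  have [measurable]: "f \<in> borel_measurable borel" using f by auto
  have "(\<integral>w. (cmod (fourier (\<lambda>x. complex_of_real (x * rect_pow p x)) w))\<^sup>2 \<partial>lborel)
     = 2 * pi * (\<integral>x. (x * rect_pow p x)\<^sup>2 \<partial>lborel)"
  proof (rule plancherel[where R = "real p"])
    show "integrable lborel (\<lambda>w. (cmod (fourier (\<lambda>x. complex_of_real (x * rect_pow p x)) w))\<^sup>2)"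
      using integrable_real_scale[OF f] ae borel_measurable_fourier[OF m]
      by (subst integrable_cong_AE[OF _ _ ae]) auto
  qed (auto intro!: continuous_intros continuous_on_rect_pow[OF p] rect_pow_support)
  also have "(\<integral>w. (cmod (fourier (\<lambda>x. complex_of_real (x * rect_pow p x)) w))\<^sup>2 \<partial>lborel) = (\<integral>w. f (w / 2) \<partial>lborel)"
    using ae borel_measurable_fourier[OF m] by (intro integral_cong_AE) auto
  also have "\<dots> = 2 * ((real p)\<^sup>2 / 4 * dsc_moment (2 * p - 2))"
    unfolding integral_real_scale[of f] by (simp add: f_def[abs_def] dsc_moment_def)
  finally show ?thesis by (simp add: power_mult_distrib field_simps)
qed

lemma uncertainty_crect_pow:
  assumes p: "2 \<le> p"
  shows "uncertainty (crect_pow p) = ennreal (sc_uncertainty p)"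
proof -
  define I Q M where "I = sc_int (2 * p)" and "Q = dsc_moment (2 * p - 2)" and "M = sc_moment (2 * p - 2)"
  have I: "0 < I" using sc_int_pos[OF p] by (simp add: I_def)
  have e: "2 * p - 2 + 2 = 2 * p" using p by simp
  have M0: "0 \<le> M" unfolding M_def sc_moment_def e
    by (intro Bochner_Integration.integral_nonneg mult_nonneg_nonneg) (auto simp: zero_le_even_power)
  have Q0: "0 \<le> Q" unfolding Q_def dsc_moment_def
    by (intro Bochner_Integration.integral_nonneg mult_nonneg_nonneg) (auto simp: zero_le_even_power)
  have "(\<integral>\<^sup>+x. ennreal ((x - mean_x (crect_pow p))\<^sup>2 * (cmod ((crect_pow p) x))\<^sup>2) \<partial>lborel) = (\<integral>\<^sup>+x. ennreal (x\<^sup>2 * (rect_pow p x)\<^sup>2) \<partial>lborel)"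
    by (simp add: mean_x_crect_pow)
  also have "\<dots> = ennreal (\<integral>x. x\<^sup>2 * (rect_pow p x)\<^sup>2 \<partial>lborel)"
  proof (rule nn_integral_eq_integral)
    show "integrable lborel (\<lambda>x. x\<^sup>2 * (rect_pow p x)\<^sup>2)"
      by (rule integrable_compact_support[of _ "real p"])
         (auto intro!: continuous_intros continuous_on_rect_pow[OF p] simp: rect_pow_support)
  qed auto
  finally have X: "var_x (crect_pow p) = ennreal ((real p)\<^sup>2 * Q / (4 * pi)) / ennreal (I / pi)"
    by (simp add: var_x_def L2_norm_crect_pow[OF p] second_moment_rect_pow[OF p] I_def Q_def)
  have F: "w\<^sup>2 * (cmod (fourier (crect_pow p) w))\<^sup>2 = 4 * ((w / 2)\<^sup>2 * sc (w / 2) ^ (2 * p))" for w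
    by (simp only: fourier_crect_pow[OF p] norm_of_real power2_abs power_even_eq) (simp add: power_divide)
  have "(\<integral>\<^sup>+w. ennreal ((w - mean_freq (crect_pow p))\<^sup>2 * (cmod (fourier (crect_pow p) w))\<^sup>2) \<partial>lborel)
     = (\<integral>\<^sup>+w. ennreal (4 * ((w / 2)\<^sup>2 * sc (w / 2) ^ (2 * p))) \<partial>lborel)"
    unfolding mean_freq_crect_pow[OF p] F[symmetric] by simp
  also have "\<dots> = ennreal (\<integral>w. 4 * ((w / 2)\<^sup>2 * sc (w / 2) ^ (2 * p)) \<partial>lborel)"
  proof (rule nn_integral_eq_integral)
    show "integrable lborel (\<lambda>w. 4 * ((w / 2)\<^sup>2 * sc (w / 2) ^ (2 * p)))"
      using integrable_sc_moment[of "2 * p - 2"] p unfolding e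
      by (intro integrable_mult_right integrable_real_scale[of "\<lambda>u. u\<^sup>2 * sc u ^ (2 * p)"]) auto
  qed (auto simp: zero_le_even_power)
  also have "(\<integral>w. 4 * ((w / 2)\<^sup>2 * sc (w / 2) ^ (2 * p)) \<partial>lborel) = 8 * M"
    unfolding integral_real_scale[of "\<lambda>u. 4 * (u\<^sup>2 * sc u ^ (2 * p))"] M_def sc_moment_def e by simp
  finally have W: "var_freq (crect_pow p) = ennreal (8 * M) / ennreal (2 * pi * (I / pi))"
    by (simp add: var_freq_def L2_norm_crect_pow[OF p] I_def)
  have "uncertainty (crect_pow p) = ennreal ((real p)\<^sup>2 * Q / (4 * pi) / (I / pi)) * ennreal (8 * M / (2 * pi * (I / pi)))"
    unfolding uncertainty_def X W using I M0 Q0 by (simp add: divide_ennreal)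
  also have "\<dots> = ennreal ((real p)\<^sup>2 * Q / (4 * pi) / (I / pi) * (8 * M / (2 * pi * (I / pi))))"
    using I M0 Q0 by (intro ennreal_mult[symmetric]) auto
  also have "(real p)\<^sup>2 * Q / (4 * pi) / (I / pi) * (8 * M / (2 * pi * (I / pi))) = sc_uncertainty p"
    unfolding sc_uncertainty_def I_def[symmetric] Q_def[symmetric] M_def[symmetric]
    using I by (simp add: field_simps power2_eq_square)
  finally show ?thesis .
qed

theorem lemma4p5:
  fixes p :: nat
  assumes "2 \<le> p"
  shows "uncertainty (\<lambda>x. complex_of_real (rect_pow (p + 1) x))
    \<le> uncertainty (\<lambda>x. complex_of_real (rect_pow p x))"
  using uncertainty_crect_pow[of p] uncertainty_crect_pow[of "p + 1"] sc_uncertainty_Suc_le[of p] assms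
  by (simp add: ennreal_leI)

end
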